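(* Let $\Lambda$, the intensities, the arrays $\mathrm B,\Theta,\mathrm E,\mathrm T$, the function $V$ and the generator $\mathbf R$ be as in the context. For $\underline y\in\{0,1\}^\Lambda$ put $$U_l(\underline y)=\sum_{n\in\mathbb Z_+}\frac{\overline\lambda_l(n;\underline y)}{\overline\mu_l(n;\underline y)},\qquad L_r(\underline y)=\sum_{n\in\mathbb Z_+}\frac{\overline\lambda_r(n;\underline y)\,\overline\gamma_r(n)}{\overline\mu_r(n;\underline y)},$$ and assume that $U_l(\underline y)<\infty$ and $L_r(\underline y)<\infty$ for all $\underline y\in\{0,1\}^\Lambda$ and $l,r\in\Lambda$ with $y_l=0$ and $y_r=1$. Then the continuous-time Markov process on $\{0,1\}^\Lambda\times\mathbb Z_+^\Lambda$ with generator $\mathbf R$ is positive recurrent and reversible. Its stationary probabilities are $$\pi(\underline y,\underline n)=\frac{V(\underline n)}{\Xi_\Lambda}\prod_{j\in\Lambda:\,y_j=1}\frac{\xi_j\overline\gamma_j(n_j)}{\eta_j},$$ $$\Xi_\Lambda=\sum_{\underline y\in\{0,1\}^\Lambda}\sum_{\underline n\in\mathbb Z_+^\Lambda}V(\underline n)\prod_{j:\,y_j=1}\frac{\xi_j\overline\gamma_j(n_j)}{\eta_j}=\sum_{\underline y\in\{0,1\}^\Lambda}\ \prod_{r:\,y_r=1}\frac{\xi_rL_r(\underline y)}{\eta_r}\prod_{l:\,y_l=0}U_l(\underline y).$$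
   Context: $\Lambda$ is a finite set of sites and $\mathbb Z_+=\{0,1,2,\dots\}$. A state is $(\underline y,\underline n)$ with $\underline y=(y_s)_{s\in\Lambda}\in\{0,1\}^\Lambda$ (configuration of sites occupied by distinguished customers) and $\underline n=(n_i)_{i\in\Lambda}\in\mathbb Z_+^\Lambda$ (numbers of tasks). Write $j\in\underline y$ if $y_j=1$ and $j\notin\underline y$ if $y_j=0$. $\underline e^i$ is the unit vector at $i$, $\underline e^{i\to k}=\underline e^k-\underline e^i$, and $\mathbf 1$ is the indicator. Intensities. $\lambda_i(n;\underline y)\ge0$ ($n\ge0$) and $\mu_i(n;\underline y)$ ($n\ge1$) satisfy $\sup\lambda_i(n;\underline y)<\infty$ and $\inf\mu_i(n;\underline y)>0$ (over all $i,n,\underline y$), and $\lambda_i(n;\underline y)>0$ whenever $\lambda_i(n+1;\underline y)>0$. The values $\gamma_i(n)\ge0$ satisfy $\gamma_i(0)=1$ and $\gamma_i(n)>0$ whenever $\gamma_i(n+1)>0$. The numbers $\xi_k>0$, $\eta_k>0$, $k\in\Lambda$, do not depend on $\underline n,\underline y$. Set $\overline\lambda_i(0;\underline y)=\overline\mu_i(0;\underline y)=\overline\gamma_i(0)=1$ and, for $n\ge1$, $$\overline\lambda_i(n;\underline y)=\prod_{0\le m<n}\lambda_i(m;\underline y),\quad \overline\mu_i(n;\underline y)=\prod_{1\le m\le n}\mu_i(m;\underline y),\quad\overline\gamma_i(n)=\prod_{0\le m<n}\gamma_i(m).$$ It is understood that $\overline\gamma_j(n_j)>0$ wherever its reciprocal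 appears below. It is assumed that for every $\underline n\in\mathbb Z_+^\Lambda$ the product $$V(\underline n)=\prod_{q\in\Lambda}\frac{\overline\lambda_q(n_q;\underline y)}{\overline\mu_q(n_q;\underline y)}$$ does not depend on $\underline y\in\{0,1\}^\Lambda$. Arrays. The collections $\mathrm B(\underline n;\underline y)=(\beta_{kl}(n_k,n_l;\underline y))$, $\Theta(\underline n;\underline y)=(\theta_{kl}(n_k,n_l;\underline y))$, $\mathrm E(\underline n;\underline y)=(\epsilon_{ij}(n_i,n_j;\underline y))$, $\mathrm T(\underline n;\underline y)=(\tau_{jj'}(\underline n;\underline y))$ are irreducible, meaning that their off-diagonal entries are strictly positive. They satisfy: $$\frac{\lambda_k(n_k-1;\underline y)}{\mu_k(n_k;\underline y)}\beta_{kl}(n_k,n_l;\underline y)=\frac{\lambda_l(n_l;\underline y)}{\mu_l(n_l+1;\underline y)}\beta_{lk}(n_l+1,n_k-1;\underline y),\quad k\ne l,\ k,l\notin\underline y,\ n_k\ge1;$$ $$\frac{\lambda_j(n_j-1;\underline y)}{\mu_j(n_j;\underline y)}\theta_{jk}(n_j,n_k;\underline y)=\frac{\lambda_k(n_k;\underline y)}{\mu_k(n_k+1;\underline y)}\theta_{kj}(n_k+1,n_j-1;\underline y),\quad j\in\underline y,\ k\notin\underline y,\ n_j\ge1;$$ $$\frac{\lambda_i(n_i-1;\underline y)\gamma_i(n_i-1)}{\mu_i(n_i;\underline y)}\epsilon_{ij}(n_i,n_j;\underline y)=\frac{\lambda_j(n_j;\underline y)\gamma_j(n_j)}{\mu_j(n_j+1;\underline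 y)}\epsilon_{ji}(n_j+1,n_i-1;\underline y),\quad i\ne j,\ i,j\in\underline y,\ n_i\ge1;$$ $$\tau_{jj'}(\underline n;\underline y)\frac{\xi_j}{\eta_j}=\tau_{j'j}(\underline n;\underline y+\underline e^{j\to j'})\frac{\xi_{j'}}{\eta_{j'}},\quad j\in\underline y,\ j'\notin\underline y.$$ The generator $\mathbf R$ has the following off-diagonal entries (all others are zero): - $R[(\underline y,\underline n);(\underline y,\underline n+\underline e^p)]=\lambda_p(n_p;\underline y)[\gamma_p(n_p)]^{y_p}$ and $R[(\underline y,\underline n);(\underline y,\underline n-\underline e^p)]=\mu_p(n_p;\underline y)\mathbf 1(n_p\ge1)$, $p\in\Lambda$; - $R[(\underline y,\underline n);(\underline y,\underline n+\underline e^{k\to l})]=\beta_{kl}(n_k,n_l;\underline y)\mathbf 1(n_k\ge1)$, $k\ne l$, $k,l\notin\underline y$; - $R[(\underline y,\underline n);(\underline y,\underline n+\underline e^{i\to j})]=\epsilon_{ij}(n_i,n_j;\underline y)\mathbf 1(n_i\ge1)$, $i\ne j$, $i,j\in\underline y$; - $R[(\underline y,\underline n);(\underline y,\underline n+\underline e^{i\to l})]=\theta_{il}(n_i,n_l;\underline y)\mathbf 1(n_i\ge1)$, $i\in\underline y$, $l\notin\underline y$; - $R[(\underline y,\underline n);(\underline y,\underline n+\underline e^{k\to j})]=\theta_{kj}(n_k,n_j;\underline y)\gamma_j(n_j)\mathbf 1(n_k\ge1)$, $j\in\underline y$, $k\notin\underline y$; - $R[(\underline y,\underline n);(\underline y+\underline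 e^{j\to j'},\underline n)]=[\overline\gamma_j(n_j)]^{-1}\tau_{jj'}(\underline n;\underline y)$, $j\in\underline y$, $j'\notin\underline y$; - $R[(\underline y,\underline n);(\underline y+\underline e^k,\underline n)]=\xi_k\overline\gamma_k(n_k)\mathbf 1(y_k=0)$ and $R[(\underline y,\underline n);(\underline y-\underline e^i,\underline n)]=\eta_i\mathbf 1(y_i=1)$, $k,i\in\Lambda$.
   Formalization: The Markov process with generator R is assumed to exist without explosion (the hypotheses permit explosion), and positive recurrent means finite mean return to every essential state plus a.s. entry into those states, since vanishing intensities can make some states transient. *)

theory Defs
  imports "HOL-Probability.Probability"
begin

section \<open>Continuous-time Markov processes on a discrete state space\<close>

text \<open>
  A process is a family of probability measures \<open>M x\<close>, one for each initial state \<open>x\<close>, together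
  with random variables \<open>X t\<close>, \<open>t \<ge> 0\<close>. Values of \<open>X\<close> at negative times are irrelevant.
\<close>

definition trans_prob ::
  "('x \<Rightarrow> 'w measure) \<Rightarrow> (real \<Rightarrow> 'w \<Rightarrow> 'x) \<Rightarrow> real \<Rightarrow> 'x \<Rightarrow> 'x \<Rightarrow> real" where
  "trans_prob M X t x z = measure (M x) {\<omega> \<in> space (M x). X t \<omega> = z}"

text \<open>
  Right-continuity and left limits in the discrete topology: the path makes only finitely many
  jumps in every bounded time interval.
\<close>

definition step_path :: "(real \<Rightarrow> 'x) \<Rightarrow> bool" where
  "step_path f \<longleftrightarrow>
     (\<forall>t\<ge>0. eventually (\<lambda>s. f s = f t) (at_right t)) \<and>
     (\<forall>t>0. \<exists>z. eventually (\<lambda>s. f s = z) (at_left t))"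

text \<open>
  A Markov jump process whose generator is the matrix \<open>R\<close> (diagonal included). It lives on the
  state space for all times, so it does not explode. The last condition says that \<open>R\<close> is the entrywise
  right derivative of the transition probabilities at time \<open>0\<close>.
\<close>

definition markov_process_with_generator ::
  "('x \<Rightarrow> 'w measure) \<Rightarrow> (real \<Rightarrow> 'w \<Rightarrow> 'x) \<Rightarrow> ('x \<Rightarrow> 'x \<Rightarrow> real) \<Rightarrow> bool" where
  "markov_process_with_generator M X R \<longleftrightarrow>
     (\<forall>x. prob_space (M x)) \<and>
     (\<forall>x. \<forall>t\<ge>0. X t \<in> measurable (M x) (count_space UNIV)) \<and>
     (\<forall>x. \<forall>\<omega>\<in>space (M x). step_path (\<lambda>t. X t \<omega>)) \<and>
     (\<forall>x. trans_prob M X 0 x x = 1) \<and>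
     (\<forall>x n (t :: nat \<Rightarrow> real) z. 0 \<le> t 0 \<longrightarrow> (\<forall>i\<le>n. t i \<le> t (Suc i)) \<longrightarrow>
        measure (M x) {\<omega> \<in> space (M x). \<forall>i\<le>Suc n. X (t i) \<omega> = z i} =
        measure (M x) {\<omega> \<in> space (M x). \<forall>i\<le>n. X (t i) \<omega> = z i} *
          trans_prob M X (t (Suc n) - t n) (z n) (z (Suc n))) \<and>
     (\<forall>x z. ((\<lambda>t. trans_prob M X t x z) has_real_derivative R x z) (at 0 within {0..}))"

definition stationary_distribution ::
  "('x \<Rightarrow> 'w measure) \<Rightarrow> (real \<Rightarrow> 'w \<Rightarrow> 'x) \<Rightarrow> ('x \<Rightarrow> real) \<Rightarrow> bool" where
  "stationary_distribution M X p \<longleftrightarrow>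
     (\<forall>x. 0 \<le> p x) \<and> (p has_sum 1) UNIV \<and>
     (\<forall>t\<ge>0. \<forall>z. ((\<lambda>x. p x * trans_prob M X t x z) has_sum p z) UNIV)"

text \<open>
  Reversibility of the process with initial distribution \<open>p\<close>: for every \<open>T\<close> the joint law of
  \<open>X (t 0), X (t 1), \<dots>\<close> coincides with that of \<open>X (T - t 0), X (T - t 1), \<dots>\<close>.
\<close>

definition reversible_process ::
  "('x \<Rightarrow> 'w measure) \<Rightarrow> (real \<Rightarrow> 'w \<Rightarrow> 'x) \<Rightarrow> ('x \<Rightarrow> real) \<Rightarrow> bool" where
  "reversible_process M X p \<longleftrightarrow>
     (\<forall>T n (t :: nat \<Rightarrow> real) z.
        (\<forall>i<n. 0 \<le> t i \<and> t i \<le> T) \<longrightarrow> (\<forall>i j. i \<le> j \<longrightarrow> j < n \<longrightarrow> t i \<le> t j) \<longrightarrow>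
        (\<Sum>\<^sub>\<infinity>x. p x * measure (M x) {\<omega> \<in> space (M x). \<forall>i<n. X (t i) \<omega> = z i}) =
        (\<Sum>\<^sub>\<infinity>x. p x * measure (M x) {\<omega> \<in> space (M x). \<forall>i<n. X (T - t i) \<omega> = z i}))"

text \<open>
  The first return time to \<open>x\<close>: the first time at \<open>x\<close> after some other state has been visited;
  it is infinite if there is no such time.
\<close>

definition return_time :: "(real \<Rightarrow> 'w \<Rightarrow> 'x) \<Rightarrow> 'x \<Rightarrow> 'w \<Rightarrow> ennreal" where
  "return_time X x \<omega> =
     Inf {ennreal t | t. 0 \<le> t \<and> X t \<omega> = x \<and> (\<exists>s. 0 \<le> s \<and> s < t \<and> X s \<omega> \<noteq> x)}"

definition accessible ::
  "('x \<Rightarrow> 'w measure) \<Rightarrow> (real \<Rightarrow> 'w \<Rightarrow> 'x) \<Rightarrow> 'x \<Rightarrow> 'x \<Rightarrow> bool" where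
  "accessible M X x z \<longleftrightarrow> (\<exists>t\<ge>0. 0 < trans_prob M X t x z)"

definition essential ::
  "('x \<Rightarrow> 'w measure) \<Rightarrow> (real \<Rightarrow> 'w \<Rightarrow> 'x) \<Rightarrow> 'x \<Rightarrow> bool" where
  "essential M X x \<longleftrightarrow> (\<forall>z. accessible M X x z \<longrightarrow> accessible M X z x)"

text \<open>
  Positive recurrence of a process that may have inessential (hence transient) states: every
  essential state has finite mean return time, and from every initial state the process enters the
  set of essential states with probability one. For an irreducible process all states are essential
  and this is the usual notion. An absorbing state counts as not positive recurrent here, because
  its return time is infinite.
\<close>

definition positive_recurrent ::
  "('x \<Rightarrow> 'w measure) \<Rightarrow> (real \<Rightarrow> 'w \<Rightarrow> 'x) \<Rightarrow> bool" where
  "positive_recurrent M X \<longleftrightarrow>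
     (\<forall>x. essential M X x \<longrightarrow> (\<integral>\<^sup>+ \<omega>. return_time X x \<omega> \<partial>M x) < \<infinity>) \<and>
     (\<forall>x. AE \<omega> in M x. \<exists>t\<ge>0. essential M X (X t \<omega>))"


section \<open>The network\<close>

text \<open>
  The finite set of sites is a finite type \<open>'s\<close>. A configuration \<open>y \<in> {0,1}^\<Lambda>\<close> is represented by
  the set of its occupied sites, so a state is a pair \<open>(y, n)\<close> of a set and a function.
\<close>

type_synonym 's state = "'s set \<times> ('s \<Rightarrow> nat)"

definition lam_bar :: "('s \<Rightarrow> nat \<Rightarrow> 's set \<Rightarrow> real) \<Rightarrow> 's \<Rightarrow> nat \<Rightarrow> 's set \<Rightarrow> real" where
  "lam_bar lam i n y = (\<Prod>m<n. lam i m y)"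

definition mu_bar :: "('s \<Rightarrow> nat \<Rightarrow> 's set \<Rightarrow> real) \<Rightarrow> 's \<Rightarrow> nat \<Rightarrow> 's set \<Rightarrow> real" where
  "mu_bar \<mu> i n y = (\<Prod>m=1..n. \<mu> i m y)"

definition gam_bar :: "('s \<Rightarrow> nat \<Rightarrow> real) \<Rightarrow> 's \<Rightarrow> nat \<Rightarrow> real" where
  "gam_bar \<gamma> i n = (\<Prod>m<n. \<gamma> i m)"

text \<open>\<open>n + e^{k\<rightarrow>l}\<close> and \<open>y + e^{j\<rightarrow>j'}\<close>\<close>

definition move_task :: "'s \<Rightarrow> 's \<Rightarrow> ('s \<Rightarrow> nat) \<Rightarrow> ('s \<Rightarrow> nat)" where
  "move_task k l n = n(k := n k - 1, l := n l + 1)"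

definition move_customer :: "'s \<Rightarrow> 's \<Rightarrow> 's set \<Rightarrow> 's set" where
  "move_customer j j' y = insert j' (y - {j})"

definition task_move_rate ::
  "('s \<Rightarrow> nat \<Rightarrow> real) \<Rightarrow> ('s \<Rightarrow> 's \<Rightarrow> nat \<Rightarrow> nat \<Rightarrow> 's set \<Rightarrow> real) \<Rightarrow>
   ('s \<Rightarrow> 's \<Rightarrow> nat \<Rightarrow> nat \<Rightarrow> 's set \<Rightarrow> real) \<Rightarrow> ('s \<Rightarrow> 's \<Rightarrow> nat \<Rightarrow> nat \<Rightarrow> 's set \<Rightarrow> real) \<Rightarrow>
   's \<Rightarrow> 's \<Rightarrow> ('s \<Rightarrow> nat) \<Rightarrow> 's set \<Rightarrow> real" where
  "task_move_rate \<gamma> \<beta> \<theta> \<epsilon> k l n y =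
     (if k \<notin> y \<and> l \<notin> y then \<beta> k l (n k) (n l) y
      else if k \<in> y \<and> l \<in> y then \<epsilon> k l (n k) (n l) y
      else if k \<in> y then \<theta> k l (n k) (n l) y
      else \<theta> k l (n k) (n l) y * \<gamma> l (n l))"

text \<open>
  The transitions out of \<open>(y, n)\<close> have pairwise distinct targets, all different from \<open>(y, n)\<close>. Hence
  at most one summand below is nonzero, and the rate from a state to itself is \<open>0\<close>.
\<close>

definition jump_rate ::
  "('s::finite \<Rightarrow> nat \<Rightarrow> 's set \<Rightarrow> real) \<Rightarrow> ('s \<Rightarrow> nat \<Rightarrow> 's set \<Rightarrow> real) \<Rightarrow> ('s \<Rightarrow> nat \<Rightarrow> real) \<Rightarrow>
   ('s \<Rightarrow> 's \<Rightarrow> nat \<Rightarrow> nat \<Rightarrow> 's set \<Rightarrow> real) \<Rightarrow> ('s \<Rightarrow> 's \<Rightarrow> nat \<Rightarrow> nat \<Rightarrow> 's set \<Rightarrow> real) \<Rightarrow>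
   ('s \<Rightarrow> 's \<Rightarrow> nat \<Rightarrow> nat \<Rightarrow> 's set \<Rightarrow> real) \<Rightarrow> ('s \<Rightarrow> 's \<Rightarrow> ('s \<Rightarrow> nat) \<Rightarrow> 's set \<Rightarrow> real) \<Rightarrow>
   ('s \<Rightarrow> real) \<Rightarrow> ('s \<Rightarrow> real) \<Rightarrow> 's state \<Rightarrow> 's state \<Rightarrow> real" where
  "jump_rate lam \<mu> \<gamma> \<beta> \<theta> \<epsilon> \<tau> \<xi> \<eta> = (\<lambda>(y, n) z.
     (\<Sum>p\<in>UNIV. lam p (n p) y * (if p \<in> y then \<gamma> p (n p) else 1)
        * of_bool (z = (y, n(p := n p + 1)))) +
     (\<Sum>p\<in>UNIV. \<mu> p (n p) y * of_bool (1 \<le> n p \<and> z = (y, n(p := n p - 1)))) +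
     (\<Sum>k\<in>UNIV. \<Sum>l\<in>UNIV - {k}. task_move_rate \<gamma> \<beta> \<theta> \<epsilon> k l n y
        * of_bool (1 \<le> n k \<and> z = (y, move_task k l n))) +
     (\<Sum>j\<in>y. \<Sum>j'\<in>-y. \<tau> j j' n y / gam_bar \<gamma> j (n j)
        * of_bool (z = (move_customer j j' y, n))) +
     (\<Sum>k\<in>-y. \<xi> k * gam_bar \<gamma> k (n k) * of_bool (z = (insert k y, n))) +
     (\<Sum>i\<in>y. \<eta> i * of_bool (z = (y - {i}, n))))"

definition generator ::
  "('s::finite \<Rightarrow> nat \<Rightarrow> 's set \<Rightarrow> real) \<Rightarrow> ('s \<Rightarrow> nat \<Rightarrow> 's set \<Rightarrow> real) \<Rightarrow> ('s \<Rightarrow> nat \<Rightarrow> real) \<Rightarrow>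
   ('s \<Rightarrow> 's \<Rightarrow> nat \<Rightarrow> nat \<Rightarrow> 's set \<Rightarrow> real) \<Rightarrow> ('s \<Rightarrow> 's \<Rightarrow> nat \<Rightarrow> nat \<Rightarrow> 's set \<Rightarrow> real) \<Rightarrow>
   ('s \<Rightarrow> 's \<Rightarrow> nat \<Rightarrow> nat \<Rightarrow> 's set \<Rightarrow> real) \<Rightarrow> ('s \<Rightarrow> 's \<Rightarrow> ('s \<Rightarrow> nat) \<Rightarrow> 's set \<Rightarrow> real) \<Rightarrow>
   ('s \<Rightarrow> real) \<Rightarrow> ('s \<Rightarrow> real) \<Rightarrow> 's state \<Rightarrow> 's state \<Rightarrow> real" where
  "generator lam \<mu> \<gamma> \<beta> \<theta> \<epsilon> \<tau> \<xi> \<eta> x z =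
     (if x = z then - (\<Sum>\<^sub>\<infinity>w\<in>- {x}. jump_rate lam \<mu> \<gamma> \<beta> \<theta> \<epsilon> \<tau> \<xi> \<eta> x w)
      else jump_rate lam \<mu> \<gamma> \<beta> \<theta> \<epsilon> \<tau> \<xi> \<eta> x z)"

definition weight ::
  "(('s \<Rightarrow> nat) \<Rightarrow> real) \<Rightarrow> ('s \<Rightarrow> nat \<Rightarrow> real) \<Rightarrow> ('s \<Rightarrow> real) \<Rightarrow> ('s \<Rightarrow> real) \<Rightarrow>
   's set \<Rightarrow> ('s \<Rightarrow> nat) \<Rightarrow> real" where
  "weight V \<gamma> \<xi> \<eta> y n = V n * (\<Prod>j\<in>y. \<xi> j * gam_bar \<gamma> j (n j) / \<eta> j)"

definition partition_function ::
  "(('s::finite \<Rightarrow> nat) \<Rightarrow> real) \<Rightarrow> ('s \<Rightarrow> nat \<Rightarrow> real) \<Rightarrow> ('s \<Rightarrow> real) \<Rightarrow> ('s \<Rightarrow> real) \<Rightarrow> real" where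
  "partition_function V \<gamma> \<xi> \<eta> = (\<Sum>y\<in>UNIV. \<Sum>\<^sub>\<infinity>n. weight V \<gamma> \<xi> \<eta> y n)"

definition stationary_prob ::
  "(('s::finite \<Rightarrow> nat) \<Rightarrow> real) \<Rightarrow> ('s \<Rightarrow> nat \<Rightarrow> real) \<Rightarrow> ('s \<Rightarrow> real) \<Rightarrow> ('s \<Rightarrow> real) \<Rightarrow>
   's state \<Rightarrow> real" where
  "stationary_prob V \<gamma> \<xi> \<eta> = (\<lambda>(y, n). V n / partition_function V \<gamma> \<xi> \<eta> *
     (\<Prod>j\<in>y. \<xi> j * gam_bar \<gamma> j (n j) / \<eta> j))"

definition U_sum ::
  "('s \<Rightarrow> nat \<Rightarrow> 's set \<Rightarrow> real) \<Rightarrow> ('s \<Rightarrow> nat \<Rightarrow> 's set \<Rightarrow> real) \<Rightarrow> 's \<Rightarrow> 's set \<Rightarrow> real" where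
  "U_sum lam \<mu> l y = (\<Sum>n. lam_bar lam l n y / mu_bar \<mu> l n y)"

definition L_sum ::
  "('s \<Rightarrow> nat \<Rightarrow> 's set \<Rightarrow> real) \<Rightarrow> ('s \<Rightarrow> nat \<Rightarrow> 's set \<Rightarrow> real) \<Rightarrow> ('s \<Rightarrow> nat \<Rightarrow> real) \<Rightarrow>
   's \<Rightarrow> 's set \<Rightarrow> real" where
  "L_sum lam \<mu> \<gamma> r y = (\<Sum>n. lam_bar lam r n y * gam_bar \<gamma> r n / mu_bar \<mu> r n y)"

end

theory Submission
  imports Defs
begin

text \<open>
  The generator satisfies detailed balance with respect to \<open>\<pi>\<close>, transition by transition. To transfer
  this to the transition probabilities of an arbitrary process with step paths, observe the process at
  the times \<open>i t / N\<close> and kill it outside a finite set \<open>K\<close>: the \<open>N\<close>-step matrix is asymptotically a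
  power of \<open>1 + (t / N) R\<close> restricted to \<open>K\<close>, which is symmetric with respect to \<open>\<pi>\<close>, and step paths
  on \<open>[0, t]\<close> stay in a large \<open>K\<close> with probability close to one. This gives stationarity and
  reversibility; positivity of the transition probabilities into the empty state gives uniqueness. The
  essential states are those with \<open>\<pi> > 0\<close>. A weight vanishes only where no task can arrive, so
  outside this set the process moves in a finite set of states until it is absorbed.
\<close>

text \<open>The process is known only through its finite-dimensional laws, its step paths and the
  entrywise derivative at time 0. Neither Kolmogorov equation is assumed and the rates may be
  unbounded, so the transition probabilities cannot be written as an exponential of
  \<open>R\<close>, and infinite row sums cannot be differentiated term by term. On a finite block
  the difference quotients converge uniformly and \<open>1 + h R\<close> is substochastic for small
  \<open>h\<close>; this is why the process is confined first. A second obstacle is that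
  \<open>\<pi>\<close> may vanish, since \<open>lam\<close> or \<open>\<gamma>\<close> can be zero
  from some occupancy on. Null states cannot be entered from the support, but they are legitimate
  initial states, so positive recurrence includes absorption into the support. Here the balance
  relations help: a possible arrival at \<open>p\<close> forces \<open>lam q m y\<close> to be
  positive at every other site \<open>q\<close> and for every \<open>m\<close>. Hence a null state
  blocks arrivals at all sites, not only at the one whose factor vanishes.\<close>

lemma prob_fiber_has_sum:
  assumes "prob_space N" and f: "f \<in> measurable N (count_space UNIV)"
    and cnt: "countable (UNIV :: 'l set)" and E: "E \<in> sets N"
  shows "((\<lambda>l :: 'l. measure N {\<omega> \<in> E. f \<omega> = l}) has_sum measure N {\<omega> \<in> E. f \<omega> \<in> S}) S"
proof -
  interpret prob_space N by fact
  have m: "{\<omega> \<in> E. f \<omega> \<in> A} \<in> sets N" for A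
  proof -
    have "{\<omega> \<in> E. f \<omega> \<in> A} = E \<inter> (f -` A \<inter> space N)" using sets.sets_into_space[OF E] by auto
    then show ?thesis using E measurable_sets[OF f, of A] by auto
  qed
  have m1: "{\<omega> \<in> E. f \<omega> = l} \<in> sets N" for l using m[of "{l}"] by simp
  show ?thesis
  proof (cases "finite S")
    case True
    have "measure N {\<omega> \<in> E. f \<omega> \<in> S} = measure N (\<Union>l\<in>S. {\<omega> \<in> E. f \<omega> = l})"
      by (rule arg_cong[where f="measure N"]) auto
    also have "\<dots> = (\<Sum>l\<in>S. measure N {\<omega> \<in> E. f \<omega> = l})"
      using True m1 by (intro finite_measure_finite_Union) (auto simp: disjoint_family_on_def)
    finally show ?thesis using True by (simp add: has_sum_finite_iff)
  next
    case False
    have cS: "countable S" using countable_subset[OF subset_UNIV cnt] .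
    define g where "g = from_nat_into S"
    have g: "bij_betw g UNIV S" unfolding g_def using bij_betw_from_nat_into[OF cS False] .
    have "(\<lambda>i. measure N {\<omega> \<in> E. f \<omega> = g i}) sums measure N (\<Union>i. {\<omega> \<in> E. f \<omega> = g i})"
      using m1 g by (intro finite_measure_UNION)
        (auto simp: disjoint_family_on_def bij_betw_def inj_on_def)
    also have "(\<Union>i. {\<omega> \<in> E. f \<omega> = g i}) = {\<omega> \<in> E. f \<omega> \<in> S}"
      using g by (auto simp: bij_betw_def)
    finally have "((\<lambda>i. measure N {\<omega> \<in> E. f \<omega> = g i}) has_sum measure N {\<omega> \<in> E. f \<omega> \<in> S}) UNIV"
      by (intro sums_nonneg_imp_has_sum) auto
    then show ?thesis
      using has_sum_reindex_bij_betw[OF g, where f="\<lambda>l. measure N {\<omega> \<in> E. f \<omega> = l}"] by simp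
  qed
qed

lemma has_sum_swap_nonneg:
  fixes f :: "'a \<Rightarrow> 'b \<Rightarrow> real"
  assumes "\<And>x y. 0 \<le> f x y" and "\<And>x. (f x has_sum g x) UNIV" and "(g has_sum s) UNIV"
    and "\<And>y. ((\<lambda>x. f x y) has_sum h y) UNIV"
  shows "(h has_sum s) UNIV"
proof -
  have "(\<lambda>(x,y). f x y) summable_on (UNIV \<times> UNIV)"
    using assms by (intro summable_on_SigmaI[where g=g]) (auto simp: summable_on_def)
  then have "((\<lambda>(x,y). f x y) has_sum s) (UNIV \<times> UNIV)"
    using assms by (intro has_sum_SigmaI[where g=g]) auto
  then have "((\<lambda>(y,x). f x y) has_sum s) (UNIV \<times> UNIV)"
    by (subst has_sum_swap) (simp add: case_prod_unfold)
  then show ?thesis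
    by (rule has_sum_SigmaD) (use assms in auto)
qed

lemma has_sum_diff:
  fixes f g :: "'a \<Rightarrow> real"
  assumes "(f has_sum a) A" "(g has_sum b) A"
  shows "((\<lambda>x. f x - g x) has_sum (a - b)) A"
  using has_sum_add[of f A a "\<lambda>x. - g x" "- b"] assms by (simp add: has_sum_uminus)

lemma has_sum_sum:
  fixes f :: "'i \<Rightarrow> 'a \<Rightarrow> real"
  assumes "\<And>i. i \<in> I \<Longrightarrow> (f i has_sum s i) A"
  shows "((\<lambda>x. \<Sum>i\<in>I. f i x) has_sum (\<Sum>i\<in>I. s i)) A"
  using assms by (induction I rule: infinite_finite_induct) (auto intro!: has_sum_add)

section \<open>Step paths and powers of a finite block of a matrix\<close>

text \<open>Compactness of \<open>{0..t}\<close>: near each time the path takes at most two values,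
  its current value and its limit from the left, and finitely many such neighbourhoods cover the
  interval.\<close>

lemma step_path_finite_range:
  fixes f :: "real \<Rightarrow> 'a"
  assumes "step_path f"
  shows "finite (f ` {0..t})"
proof -
  have "\<exists>U. open U \<and> s \<in> U \<and> finite (f ` (U \<inter> {0..}))" if s: "s \<in> {0..t}" for s
  proof -
    obtain b where b: "b > s" "\<And>u. s < u \<Longrightarrow> u < b \<Longrightarrow> f u = f s"
    proof -
      have "eventually (\<lambda>u. f u = f s) (at_right s)" using assms s by (auto simp: step_path_def)
      then show thesis using that unfolding eventually_at_right_field by blast
    qed
    obtain a z where a: "a < s" "\<And>u. 0 \<le> u \<Longrightarrow> a < u \<Longrightarrow> u < s \<Longrightarrow> f u = z"
    proof (cases "s = 0")
      case True
      \<comment> \<open>At time 0 there is no left limit, but no \<open>u\<close> satisfies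
        \<open>0 \<le> u\<close> and \<open>u < 0\<close>, so any value serves.\<close>
      then show thesis using that[of "-1" undefined] by auto
    next
      case False
      then obtain z where "eventually (\<lambda>u. f u = z) (at_left s)"
        using assms s unfolding step_path_def by (metis atLeastAtMost_iff order_le_less)
      then obtain a where "a < s" "\<And>u. a < u \<Longrightarrow> u < s \<Longrightarrow> f u = z"
        unfolding eventually_at_left_field by blast
      then show thesis using that by blast
    qed
    have "f ` ({a<..<b} \<inter> {0..}) \<subseteq> {z, f s}"
    proof (rule image_subsetI)
      fix u assume "u \<in> {a<..<b} \<inter> {0..}"
      then show "f u \<in> {z, f s}"
        using a(2)[of u] b(2)[of u] by (cases u s rule: linorder_cases) auto
    qed
    then show ?thesis using a(1) b(1)
      by (intro exI[of _ "{a<..<b}"]) (auto intro: finite_subset)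
  qed
  then obtain U where U: "\<And>s. s \<in> {0..t} \<Longrightarrow> open (U s) \<and> s \<in> U s \<and> finite (f ` (U s \<inter> {0..}))"
    by metis
  obtain C where C: "C \<subseteq> {0..t}" "finite C" "{0..t} \<subseteq> (\<Union>s\<in>C. U s)"
    using U by (rule_tac compactE_image[of "{0..t}" "{0..t}" U]) auto
  have "f ` {0..t} \<subseteq> (\<Union>s\<in>C. f ` (U s \<inter> {0..}))" using C by fastforce
  moreover have "finite (\<Union>s\<in>C. f ` (U s \<inter> {0..}))" using C U by blast
  ultimately show ?thesis by (rule finite_subset)
qed

text \<open>The recursion appends the new step on the right, as \<open>restricted_prob_Suc\<close>
  does. For \<open>x\<close> and \<open>z\<close> in \<open>K\<close> this is an entry of a power of
  the \<open>K\<close>-block of \<open>B\<close>.\<close>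

primrec sub_power :: "'x set \<Rightarrow> ('x \<Rightarrow> 'x \<Rightarrow> real) \<Rightarrow> nat \<Rightarrow> 'x \<Rightarrow> 'x \<Rightarrow> real" where
  "sub_power K B 0 x z = of_bool (x = z)"
| "sub_power K B (Suc k) x z = (\<Sum>w\<in>K. sub_power K B k x w * B w z)"

text \<open>Needed because reversing a path turns its last step into its first.\<close>

lemma sub_power_Suc_left:
  assumes "finite K" "x \<in> K" "z \<in> K"
  shows "sub_power K B (Suc k) x z = (\<Sum>w\<in>K. B x w * sub_power K B k w z)"
  using assms(3)
proof (induction k arbitrary: z)
  case 0
  have "(\<Sum>w\<in>K. of_bool (x = w) * B w z) = (\<Sum>w\<in>K. if x = w then B w z else 0)"
    by (intro sum.cong) auto
  moreover have "(\<Sum>w\<in>K. B x w * of_bool (w = z)) = (\<Sum>w\<in>K. if z = w then B x w else 0)"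
    by (intro sum.cong) auto
  ultimately show ?case using assms 0 by (simp add: sum.delta)
next
  case (Suc k)
  have "sub_power K B (Suc (Suc k)) x z = (\<Sum>w\<in>K. (\<Sum>v\<in>K. B x v * sub_power K B k v w) * B w z)"
    unfolding sub_power.simps(2)[of K B "Suc k"] by (intro sum.cong refl) (simp only: Suc.IH)
  also have "\<dots> = (\<Sum>w\<in>K. \<Sum>v\<in>K. B x v * (sub_power K B k v w * B w z))"
    by (simp add: sum_distrib_right mult.assoc)
  also have "\<dots> = (\<Sum>v\<in>K. \<Sum>w\<in>K. B x v * (sub_power K B k v w * B w z))" by (rule sum.swap)
  also have "\<dots> = (\<Sum>w\<in>K. B x w * sub_power K B (Suc k) w z)" by (simp add: sum_distrib_left)
  finally show ?case .
qed

text \<open>Each induction step carries \<open>c\<close> across one edge by \<open>sym\<close>; in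
  the reversed product the new factor stands on the left.\<close>

lemma sub_power_symmetric:
  assumes K: "finite K" and sym: "\<And>x z. c x * B x z = c z * B z x" and "x \<in> K" "z \<in> K"
  shows "c x * sub_power K B k x z = c z * sub_power K B k z x"
  using assms(3,4)
proof (induction k arbitrary: x z)
  case (Suc k)
  have "c x * sub_power K B (Suc k) x z = (\<Sum>w\<in>K. (c x * sub_power K B k x w) * B w z)"
    by (simp add: sum_distrib_left mult.assoc)
  also have "\<dots> = (\<Sum>w\<in>K. (c w * B w z) * sub_power K B k w x)"
    using Suc by (intro sum.cong) (auto simp: mult_ac)
  also have "\<dots> = (\<Sum>w\<in>K. (c z * B z w) * sub_power K B k w x)" by (simp only: sym[of _ z])
  also have "\<dots> = c z * sub_power K B (Suc k) z x"
    using Suc.prems by (simp only: sub_power_Suc_left[OF K]) (simp add: sum_distrib_left mult.assoc)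
  finally show ?case .
qed auto

text \<open>Write \<open>a A - b B = a (A - B) + (a - b) B\<close>. The entries of \<open>a\<close>
  are at most 1, and the rows of \<open>B\<close> sum to at most 1, so old errors are not amplified
  and new ones merely add up. The sequence \<open>a\<close> is abstract so that killed probabilities
  can be inserted through their recursion on \<open>K\<close>.\<close>

lemma sub_power_perturbation:
  fixes a :: "nat \<Rightarrow> 'x \<Rightarrow> real"
  assumes K: "finite K"
    and a_0: "\<And>z. z \<in> K \<Longrightarrow> a 0 z = of_bool (x = z)"
    and a_Suc: "\<And>k z. z \<in> K \<Longrightarrow> a (Suc k) z = (\<Sum>w\<in>K. a k w * A w z)"
    and a_bound: "\<And>k w. 0 \<le> a k w" "\<And>k w. a k w \<le> 1"
    and B_nonneg: "\<And>w z. w \<in> K \<Longrightarrow> z \<in> K \<Longrightarrow> 0 \<le> B w z"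
    and B_row: "\<And>w. w \<in> K \<Longrightarrow> (\<Sum>z\<in>K. B w z) \<le> 1"
  shows "(\<Sum>z\<in>K. \<bar>a k z - sub_power K B k x z\<bar>) \<le> real k * (\<Sum>w\<in>K. \<Sum>z\<in>K. \<bar>A w z - B w z\<bar>)"
proof (induction k)
  case 0
  then show ?case by (simp add: a_0)
next
  case (Suc k)
  let ?b = "sub_power K B k x"
  have "(\<Sum>z\<in>K. \<bar>a (Suc k) z - sub_power K B (Suc k) x z\<bar>)
      \<le> (\<Sum>z\<in>K. \<Sum>w\<in>K. \<bar>A w z - B w z\<bar> + \<bar>a k w - ?b w\<bar> * B w z)"
  proof (rule sum_mono)
    fix z assume z: "z \<in> K"
    have "\<bar>a (Suc k) z - sub_power K B (Suc k) x z\<bar> = \<bar>\<Sum>w\<in>K. a k w * A w z - ?b w * B w z\<bar>"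
      by (simp add: a_Suc[OF z] sum_subtractf)
    also have "\<dots> \<le> (\<Sum>w\<in>K. \<bar>a k w * A w z - ?b w * B w z\<bar>)" by (rule sum_abs)
    also have "\<dots> \<le> (\<Sum>w\<in>K. \<bar>A w z - B w z\<bar> + \<bar>a k w - ?b w\<bar> * B w z)"
    proof (rule sum_mono)
      fix w assume w: "w \<in> K"
      have "a k w * A w z - ?b w * B w z = a k w * (A w z - B w z) + (a k w - ?b w) * B w z"
        by (simp add: algebra_simps)
      also have "\<bar>\<dots>\<bar> \<le> \<bar>a k w * (A w z - B w z)\<bar> + \<bar>(a k w - ?b w) * B w z\<bar>" by (rule abs_triangle_ineq)
      also have "\<dots> \<le> \<bar>A w z - B w z\<bar> + \<bar>a k w - ?b w\<bar> * B w z"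
        using a_bound[of k w] B_nonneg[OF w z] by (simp add: abs_mult mult_left_le_one_le)
      finally show "\<bar>a k w * A w z - ?b w * B w z\<bar> \<le> \<bar>A w z - B w z\<bar> + \<bar>a k w - ?b w\<bar> * B w z" .
    qed
    finally show "\<bar>a (Suc k) z - sub_power K B (Suc k) x z\<bar>
      \<le> (\<Sum>w\<in>K. \<bar>A w z - B w z\<bar> + \<bar>a k w - ?b w\<bar> * B w z)" .
  qed
  also have "\<dots> = (\<Sum>w\<in>K. \<Sum>z\<in>K. \<bar>A w z - B w z\<bar> + \<bar>a k w - ?b w\<bar> * B w z)" by (rule sum.swap)
  also have "\<dots> = (\<Sum>w\<in>K. \<Sum>z\<in>K. \<bar>A w z - B w z\<bar>) + (\<Sum>w\<in>K. \<bar>a k w - ?b w\<bar> * (\<Sum>z\<in>K. B w z))"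
    by (simp add: sum.distrib sum_distrib_left)
  also have "(\<Sum>w\<in>K. \<bar>a k w - ?b w\<bar> * (\<Sum>z\<in>K. B w z)) \<le> (\<Sum>w\<in>K. \<bar>a k w - ?b w\<bar>)"
    using B_row by (intro sum_mono) (simp add: mult_left_le)
  also have "\<dots> \<le> real k * (\<Sum>w\<in>K. \<Sum>z\<in>K. \<bar>A w z - B w z\<bar>)" by (rule Suc.IH)
  finally show ?case by (simp add: algebra_simps)
qed

section \<open>Jump processes observed on a time lattice\<close>

locale jump_process =
  fixes M :: "'x \<Rightarrow> 'w measure" and X :: "real \<Rightarrow> 'w \<Rightarrow> 'x" and R :: "'x \<Rightarrow> 'x \<Rightarrow> real"
  assumes markov_process: "markov_process_with_generator M X R"
    and countable_states: "countable (UNIV :: 'x set)"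
begin

abbreviation p :: "real \<Rightarrow> 'x \<Rightarrow> 'x \<Rightarrow> real" where
  "p \<equiv> trans_prob M X"

text \<open>A list rather than a function of time, so that paths range over a countable type and
  events of the past can be summed over its values. Time 0 is included, hence \<open>Suc k\<close>
  entries.\<close>

definition lattice_path :: "real \<Rightarrow> nat \<Rightarrow> 'w \<Rightarrow> 'x list" where
  "lattice_path h k \<omega> = map (\<lambda>i. X (real i * h) \<omega>) [0..<Suc k]"

lemma prob_space_M: "prob_space (M x)"
  and measurable_X: "0 \<le> t \<Longrightarrow> X t \<in> measurable (M x) (count_space UNIV)"
  and step_path_X: "\<omega> \<in> space (M x) \<Longrightarrow> step_path (\<lambda>t. X t \<omega>)"
  and p_0_same: "p 0 x x = 1"
  and p_deriv: "((\<lambda>t. p t x y) has_real_derivative R x y) (at 0 within {0..})"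
  using markov_process unfolding markov_process_with_generator_def by blast+

lemma markov_property:
  fixes t :: "nat \<Rightarrow> real"
  assumes "0 \<le> t 0" "\<And>i. i \<le> n \<Longrightarrow> t i \<le> t (Suc i)"
  shows "measure (M x) {\<omega> \<in> space (M x). \<forall>i\<le>Suc n. X (t i) \<omega> = z i} =
    measure (M x) {\<omega> \<in> space (M x). \<forall>i\<le>n. X (t i) \<omega> = z i} * p (t (Suc n) - t n) (z n) (z (Suc n))"
  using assms markov_process unfolding markov_process_with_generator_def by blast

lemma sets_X: "0 \<le> t \<Longrightarrow> {\<omega> \<in> space (M x). X t \<omega> \<in> A} \<in> sets (M x)"
  using measurable_sets[OF measurable_X, of t A x] by (simp add: vimage_def Int_def conj_commute)

lemma sets_X_pred: "0 \<le> t \<Longrightarrow> {\<omega> \<in> space (M x). P (X t \<omega>)} \<in> sets (M x)"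
  using sets_X[of t x "Collect P"] by simp

lemma p_nonneg: "0 \<le> p t x z"
  by (simp add: trans_prob_def)

lemma p_has_sum:
  assumes "0 \<le> t"
  shows "(p t x has_sum measure (M x) {\<omega> \<in> space (M x). X t \<omega> \<in> A}) A"
  using prob_fiber_has_sum[OF prob_space_M measurable_X countable_states sets.top, OF assms]
  unfolding trans_prob_def by simp

lemma p_sum_1: "0 \<le> t \<Longrightarrow> (p t x has_sum 1) UNIV"
  using p_has_sum[of t x UNIV] prob_space.prob_space[OF prob_space_M[of x]] by simp

lemma p_sum_le_1: "0 \<le> t \<Longrightarrow> finite A \<Longrightarrow> sum (p t x) A \<le> 1"
  using p_has_sum[of t x A] prob_space.prob_le_1[OF prob_space_M]
  by (metis has_sum_finite has_sum_unique)

lemma p_0: "p 0 x z = of_bool (x = z)"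
proof (cases "x = z")
  case False
  have "p 0 x x + p 0 x z \<le> 1" using p_sum_le_1[of 0 "{x,z}" x] False by simp
  then show ?thesis using p_0_same[of x] p_nonneg[of 0 x z] False by simp
qed (simp add: p_0_same)

lemma AE_X_0: "AE \<omega> in M x. X 0 \<omega> = x"
proof -
  interpret prob_space "M x" by (rule prob_space_M)
  have "measure (M x) {\<omega> \<in> space (M x). X 0 \<omega> = x} = 1"
    using p_0_same[of x] by (simp add: trans_prob_def)
  then show ?thesis using sets_X_pred[of 0 x "\<lambda>y. y = x"]
    by (subst (asm) prob_Collect_eq_1) auto
qed

lemma two_time_markov:
  assumes "0 \<le> s" "0 \<le> t"
  shows "measure (M x) {\<omega> \<in> space (M x). X s \<omega> = w \<and> X (s + t) \<omega> = z} = p s x w * p t w z"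
proof -
  define u where "u i = (if i = 0 then s else s + t)" for i :: nat
  define y where "y i = (if i = 0 then w else z)" for i :: nat
  have "measure (M x) {\<omega> \<in> space (M x). \<forall>i\<le>Suc 0. X (u i) \<omega> = y i} =
    measure (M x) {\<omega> \<in> space (M x). \<forall>i\<le>0. X (u i) \<omega> = y i} * p (u (Suc 0) - u 0) (y 0) (y (Suc 0))"
    using assms by (intro markov_property) (auto simp: u_def)
  moreover have "(\<forall>i\<le>Suc 0. X (u i) \<omega> = y i) \<longleftrightarrow> X s \<omega> = w \<and> X (s + t) \<omega> = z" for \<omega>
    by (auto simp: u_def y_def le_Suc_eq)
  ultimately show ?thesis by (simp add: u_def y_def trans_prob_def)
qed

lemma measurable_lattice_path:
  assumes "0 \<le> h"
  shows "lattice_path h k \<in> measurable (M x) (count_space UNIV)"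
proof (subst measurable_count_space_eq_countable)
  show "countable (UNIV :: 'x list set)" using countable_lists[OF countable_states] by simp
  have "lattice_path h k -` {l} \<inter> space (M x) \<in> sets (M x)" for l
  proof (cases "length l = Suc k")
    case True
    have "lattice_path h k -` {l} \<inter> space (M x) =
      space (M x) \<inter> (\<Inter>i\<in>{..k}. {\<omega> \<in> space (M x). X (real i * h) \<omega> = l ! i})"
      using True by (auto simp: lattice_path_def list_eq_iff_nth_eq less_Suc_eq_le nth_append simp del: upt_Suc)
    also have "\<dots> \<in> sets (M x)"
      using assms by (intro sets.Int sets.top sets.finite_INT sets_X_pred) auto
    finally show ?thesis .
  next
    case False
    then have "lattice_path h k -` {l} = {}" by (auto simp: lattice_path_def)
    then show ?thesis by simp
  qed
  then show "lattice_path h k \<in> space (M x) \<rightarrow> UNIV \<and>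
    (\<forall>l\<in>UNIV. lattice_path h k -` {l} \<inter> space (M x) \<in> sets (M x))" by blast
qed

lemma length_lattice_path [simp]: "length (lattice_path h k \<omega>) = Suc k"
  by (simp add: lattice_path_def)

lemma nth_lattice_path [simp]: "i \<le> k \<Longrightarrow> lattice_path h k \<omega> ! i = X (real i * h) \<omega>"
  unfolding lattice_path_def by (subst nth_map) (auto simp del: upt_Suc)

lemma lattice_path_eq_iff:
  "length l = Suc k \<Longrightarrow> lattice_path h k \<omega> = l \<longleftrightarrow> (\<forall>i\<le>k. X (real i * h) \<omega> = l ! i)"
  by (auto simp: list_eq_iff_nth_eq less_Suc_eq_le)

lemma sets_lattice_path:
  assumes "0 \<le> h" shows "{\<omega> \<in> space (M x). Q (lattice_path h k \<omega>)} \<in> sets (M x)"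
  using measurable_sets[OF measurable_lattice_path, of h "Collect Q" k x] assms
  by (simp add: vimage_def Int_def conj_commute)

text \<open>The defining Markov property concerns one exact past. Summing it over the countably many
  lattice paths that satisfy \<open>Q\<close> and end in \<open>w\<close> extends it to an arbitrary
  event of the lattice past.\<close>

lemma markov_lattice:
  assumes h: "0 \<le> h"
  shows "measure (M x) {\<omega> \<in> space (M x). Q (lattice_path h k \<omega>) \<and> X (real k * h) \<omega> = w
           \<and> X (real (Suc k) * h) \<omega> = z} =
         measure (M x) {\<omega> \<in> space (M x). Q (lattice_path h k \<omega>) \<and> X (real k * h) \<omega> = w} * p h w z"
proof -
  define S where "S = {l. length l = Suc k \<and> Q l \<and> l ! k = w}"
  have cl: "countable (UNIV :: 'x list set)" using countable_lists[OF countable_states] by simp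
  let ?E = "{\<omega> \<in> space (M x). X (real (Suc k) * h) \<omega> = z}"
  have E: "?E \<in> sets (M x)" using h by (intro sets_X_pred) auto
  have *: "measure (M x) {\<omega> \<in> ?E. lattice_path h k \<omega> = l} =
      measure (M x) {\<omega> \<in> space (M x). lattice_path h k \<omega> = l} * p h w z" if "l \<in> S" for l
  proof -
    have len: "length l = Suc k" and lk: "l ! k = w" using that by (auto simp: S_def)
    define y where "y i = (if i \<le> k then l ! i else z)" for i
    have "measure (M x) {\<omega> \<in> space (M x). \<forall>i\<le>Suc k. X (real i * h) \<omega> = y i} =
        measure (M x) {\<omega> \<in> space (M x). \<forall>i\<le>k. X (real i * h) \<omega> = y i} *
          p (real (Suc k) * h - real k * h) (y k) (y (Suc k))"
      using h by (intro markov_property) (auto intro: mult_right_mono)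
    moreover have "{\<omega> \<in> space (M x). \<forall>i\<le>Suc k. X (real i * h) \<omega> = y i} = {\<omega> \<in> ?E. lattice_path h k \<omega> = l}"
      using len by (auto simp: lattice_path_eq_iff y_def le_Suc_eq)
    moreover have "{\<omega> \<in> space (M x). \<forall>i\<le>k. X (real i * h) \<omega> = y i} = {\<omega> \<in> space (M x). lattice_path h k \<omega> = l}"
      using len by (auto simp: lattice_path_eq_iff y_def)
    ultimately show ?thesis using lk by (simp add: y_def algebra_simps)
  qed
  have "((\<lambda>l. measure (M x) {\<omega> \<in> space (M x). lattice_path h k \<omega> = l} * p h w z) has_sum
      measure (M x) {\<omega> \<in> space (M x). lattice_path h k \<omega> \<in> S} * p h w z) S"
    by (intro has_sum_cmult_left prob_fiber_has_sum[OF prob_space_M measurable_lattice_path cl sets.top] h)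
  moreover have "((\<lambda>l. measure (M x) {\<omega> \<in> ?E. lattice_path h k \<omega> = l}) has_sum
      measure (M x) {\<omega> \<in> ?E. lattice_path h k \<omega> \<in> S}) S"
    by (intro prob_fiber_has_sum[OF prob_space_M measurable_lattice_path cl E] h)
  then have "((\<lambda>l. measure (M x) {\<omega> \<in> space (M x). lattice_path h k \<omega> = l} * p h w z) has_sum
      measure (M x) {\<omega> \<in> ?E. lattice_path h k \<omega> \<in> S}) S"
    using * by (subst (asm) has_sum_cong) auto
  ultimately have "measure (M x) {\<omega> \<in> ?E. lattice_path h k \<omega> \<in> S} =
     measure (M x) {\<omega> \<in> space (M x). lattice_path h k \<omega> \<in> S} * p h w z"
    by (rule has_sum_unique[rotated])
  moreover have "{\<omega> \<in> ?E. lattice_path h k \<omega> \<in> S} = {\<omega> \<in> space (M x). Q (lattice_path h k \<omega>)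
     \<and> X (real k * h) \<omega> = w \<and> X (real (Suc k) * h) \<omega> = z}" by (auto simp: S_def)
  moreover have "{\<omega> \<in> space (M x). lattice_path h k \<omega> \<in> S} =
     {\<omega> \<in> space (M x). Q (lattice_path h k \<omega>) \<and> X (real k * h) \<omega> = w}" by (auto simp: S_def)
  ultimately show ?thesis by simp
qed

lemma markov_lattice_has_sum:
  assumes h: "0 \<le> h"
  shows "((\<lambda>w. measure (M x) {\<omega> \<in> space (M x). Q (lattice_path h k \<omega>) \<and> X (real k * h) \<omega> = w} * p h w z)
     has_sum measure (M x) {\<omega> \<in> space (M x). Q (lattice_path h k \<omega>) \<and> X (real (Suc k) * h) \<omega> = z}) UNIV"
proof -
  have "{\<omega> \<in> space (M x). Q (lattice_path h k \<omega>)} \<inter> {\<omega> \<in> space (M x). X (real (Suc k) * h) \<omega> = z} \<in> sets (M x)"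
    using h by (intro sets.Int sets_lattice_path sets_X_pred) auto
  then have E: "{\<omega> \<in> space (M x). Q (lattice_path h k \<omega>) \<and> X (real (Suc k) * h) \<omega> = z} \<in> sets (M x)"
    by (simp add: Int_def conj_ac cong: conj_cong)
  have "0 \<le> real k * h" using h by simp
  note prob_fiber_has_sum[OF prob_space_M measurable_X[OF this] countable_states E, of UNIV]
  then show ?thesis
    by (simp add: markov_lattice[OF h, symmetric] conj_ac cong: conj_cong)
qed

lemma chapman_kolmogorov:
  assumes "0 \<le> s" "0 \<le> t"
  shows "((\<lambda>w. p s x w * p t w z) has_sum p (s + t) x z) UNIV"
proof -
  have E: "{\<omega> \<in> space (M x). X (s + t) \<omega> = z} \<in> sets (M x)" using assms by (intro sets_X_pred) auto
  show ?thesis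
    using prob_fiber_has_sum[OF prob_space_M measurable_X[OF assms(1)] countable_states E, of UNIV]
    unfolding two_time_markov[OF assms, symmetric]
    by (simp add: trans_prob_def conj_ac cong: conj_cong)
qed

lemma p_mult_le:
  assumes "0 \<le> s" "0 \<le> t"
  shows "p s x w * p t w z \<le> p (s + t) x z"
proof (rule has_sum_mono2)
  show "((\<lambda>w. p s x w * p t w z) has_sum p s x w * p t w z) {w}" by (simp add: has_sum_finite_iff)
  show "((\<lambda>w. p s x w * p t w z) has_sum p (s + t) x z) UNIV" by (rule chapman_kolmogorov[OF assms])
qed (auto simp: p_nonneg)

section \<open>Rates as limits of difference quotients\<close>

lemma p_quotient_limit: "((\<lambda>h. (p h x z - of_bool (x = z)) / h) \<longlongrightarrow> R x z) (at_right 0)"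
  using p_deriv[of x z] unfolding has_field_derivative_iff at_within_Ici_at_right
  by (simp add: p_0)

lemma R_nonneg: "x \<noteq> z \<Longrightarrow> 0 \<le> R x z"
  using p_quotient_limit[of x z]
  by (rule tendsto_lowerbound) (auto simp: eventually_at_right_field p_nonneg intro!: exI[of _ 1])

text \<open>The difference quotients add up to \<open>(sum (p h x) K - 1) / h\<close>, which is at
  most 0, and only a finite sum is passed to the limit. This bounds the rows of the blocks of
  \<open>1 + h R\<close>.\<close>

lemma R_row_sum_le_0:
  assumes "finite K" "x \<in> K"
  shows "(\<Sum>z\<in>K. R x z) \<le> 0"
proof (rule tendsto_upperbound)
  show "((\<lambda>h. \<Sum>z\<in>K. (p h x z - of_bool (x = z)) / h) \<longlongrightarrow> (\<Sum>z\<in>K. R x z)) (at_right 0)"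
    by (intro tendsto_sum p_quotient_limit)
  have "(\<Sum>z\<in>K. (p h x z - of_bool (x = z)) / h) \<le> 0" if "h > 0" for h
  proof -
    have "(\<Sum>z\<in>K. of_bool (x = z)) = (\<Sum>z\<in>K. if x = z then 1 else 0 :: real)"
      by (intro sum.cong) auto
    also have "\<dots> = 1" using assms by simp
    finally show ?thesis using p_sum_le_1[of h K x] that assms
      by (simp add: sum_divide_distrib[symmetric] sum_subtractf divide_le_0_iff)
  qed
  then show "\<forall>\<^sub>F h in at_right 0. (\<Sum>z\<in>K. (p h x z - of_bool (x = z)) / h) \<le> 0"
    by (auto simp: eventually_at_right_field intro!: exI[of _ 1])
qed simp

lemma lattice_path_Suc: "lattice_path h (Suc k) \<omega> = lattice_path h k \<omega> @ [X (real (Suc k) * h) \<omega>]"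
  by (simp add: lattice_path_def)

lemma X_in_lattice_path: "X (real k * h) \<omega> \<in> set (lattice_path h k \<omega>)"
  by (simp add: lattice_path_def)

text \<open>The finite sets \<open>K j\<close> exhaust the states, and a path with finite range on
  \<open>{0..t}\<close> lies in one of them; continuity of the measure from below does the
  rest.\<close>

lemma paths_in_finite_set:
  assumes t: "0 \<le> t" and e: "0 < e"
  shows "\<exists>K. finite K \<and> (\<forall>K' N. K \<subseteq> K' \<longrightarrow>
    1 - e \<le> measure (M x) {\<omega> \<in> space (M x). set (lattice_path (t / real N) N \<omega>) \<subseteq> K'})"
proof -
  interpret prob_space "M x" by (rule prob_space_M)
  define K where "K j = {w :: 'x. to_nat_on UNIV w \<le> j}" for j
  \<comment> \<open>All \<open>N\<close> at once, so that the set found does not depend on the mesh;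
    countably many conditions keep \<open>G A\<close> measurable.\<close>
  define G where "G A = {\<omega> \<in> space (M x). \<forall>N. set (lattice_path (t / real N) N \<omega>) \<subseteq> A}" for A
  have fin: "finite (K j)" for j
  proof -
    have "K j = to_nat_on UNIV -` {..j}" by (auto simp: K_def)
    then show ?thesis using finite_vimageI[OF finite_atMost inj_on_to_nat_on[OF countable_states]] by simp
  qed
  have sets_path: "{\<omega> \<in> space (M x). set (lattice_path (t / real N) N \<omega>) \<subseteq> A} \<in> sets (M x)" for N A
    using t by (intro sets_lattice_path) simp
  have sets_G: "G A \<in> sets (M x)" for A
  proof -
    have "G A = (\<Inter>N. {\<omega> \<in> space (M x). set (lattice_path (t / real N) N \<omega>) \<subseteq> A})"
      by (auto simp: G_def)
    also have "\<dots> \<in> sets (M x)" using sets_path by (intro sets.countable_INT') auto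
    finally show ?thesis .
  qed
  have "(\<lambda>j. prob (G (K j))) \<longlonglongrightarrow> prob (\<Union>j. G (K j))"
    using sets_G by (intro finite_Lim_measure_incseq) (auto simp: incseq_def G_def K_def, fastforce)
  also have "(\<Union>j. G (K j)) = space (M x)"
  proof
    show "space (M x) \<subseteq> (\<Union>j. G (K j))"
    proof
      fix \<omega> assume \<omega>: "\<omega> \<in> space (M x)"
      let ?S = "(\<lambda>t. X t \<omega>) ` {0..t}"
      have S: "finite ?S" by (rule step_path_finite_range[OF step_path_X[OF \<omega>]])
      define j where "j = Max (to_nat_on UNIV ` ?S)"
      have "?S \<subseteq> K j" using S by (auto simp: K_def j_def intro!: Max_ge)
      moreover have "set (lattice_path (t / real N) N \<omega>) \<subseteq> ?S" for N
      proof -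
        \<comment> \<open>For \<open>N = 0\<close> the mesh \<open>t / real N\<close> is 0 and the
          only observed time is 0.\<close>
        have "real i * (t / real N) \<in> {0..t}" if "i \<le> N" for i
          using that t by (cases "N = 0") (auto simp: field_simps intro: mult_left_mono)
        then show ?thesis by (auto simp: lattice_path_def simp del: upt_Suc)
      qed
      ultimately show "\<omega> \<in> (\<Union>j. G (K j))" using \<omega> by (fastforce simp: G_def)
    qed
  qed (auto simp: G_def)
  finally have "(\<lambda>j. prob (G (K j))) \<longlonglongrightarrow> 1" by (simp add: prob_space)
  then have "\<forall>\<^sub>F j in sequentially. 1 - e < prob (G (K j))" using e by (intro order_tendstoD) auto
  then obtain j where j: "1 - e < prob (G (K j))" by (auto simp: eventually_sequentially)
  have "1 - e \<le> prob {\<omega> \<in> space (M x). set (lattice_path (t / real N) N \<omega>) \<subseteq> K'}"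
    if "K j \<subseteq> K'" for K' N
  proof -
    have "prob (G (K j)) \<le> prob {\<omega> \<in> space (M x). set (lattice_path (t / real N) N \<omega>) \<subseteq> K'}"
      using that by (intro finite_measure_mono sets_path) (auto simp: G_def)
    then show ?thesis using j by simp
  qed
  then show ?thesis using fin by blast
qed

definition restricted_prob :: "'x set \<Rightarrow> real \<Rightarrow> nat \<Rightarrow> 'x \<Rightarrow> 'x \<Rightarrow> real" where
  "restricted_prob K h k x z =
     measure (M x) {\<omega> \<in> space (M x). set (lattice_path h k \<omega>) \<subseteq> K \<and> X (real k * h) \<omega> = z}"

lemma restricted_prob_0:
  assumes "z \<in> K"
  shows "restricted_prob K h 0 x z = of_bool (x = z)"
proof -
  have "{\<omega> \<in> space (M x). set (lattice_path h 0 \<omega>) \<subseteq> K \<and> X (real 0 * h) \<omega> = z} =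
      {\<omega> \<in> space (M x). X 0 \<omega> = z}" using assms by (auto simp: lattice_path_def)
  then show ?thesis unfolding restricted_prob_def p_0[symmetric] trans_prob_def by simp
qed

lemma restricted_prob_Suc:
  assumes "finite K" "z \<in> K" "0 \<le> h"
  shows "restricted_prob K h (Suc k) x z = (\<Sum>w\<in>K. restricted_prob K h k x w * p h w z)"
proof -
  have "restricted_prob K h k x w = 0" if "w \<notin> K" for w
  proof -
    have *: "{\<omega> \<in> space (M x). set (lattice_path h k \<omega>) \<subseteq> K \<and> X (real k * h) \<omega> = w} = {}"
      using that X_in_lattice_path[of k h] by blast
    show ?thesis unfolding restricted_prob_def * by simp
  qed
  then have "((\<lambda>w. restricted_prob K h k x w * p h w z) has_sum
      (\<Sum>w\<in>K. restricted_prob K h k x w * p h w z)) UNIV"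
    using assms by (intro has_sum_finite_neutralI) auto
  moreover have "((\<lambda>w. restricted_prob K h k x w * p h w z) has_sum restricted_prob K h (Suc k) x z) UNIV"
  proof -
    have "{\<omega> \<in> space (M x). set (lattice_path h (Suc k) \<omega>) \<subseteq> K \<and> X (real (Suc k) * h) \<omega> = z} =
      {\<omega> \<in> space (M x). set (lattice_path h k \<omega>) \<subseteq> K \<and> X (real (Suc k) * h) \<omega> = z}"
      using assms by (auto simp: lattice_path_Suc)
    then show ?thesis
      using markov_lattice_has_sum[OF assms(3), of x "\<lambda>l. set l \<subseteq> K" k z]
      by (simp add: restricted_prob_def)
  qed
  ultimately show ?thesis by (metis has_sum_unique)
qed

text \<open>The difference is the probability of the paths that end in \<open>z\<close> but are
  outside \<open>K\<close> at some lattice time; \<open>0 < N\<close> makes \<open>t\<close> the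
  last lattice time.\<close>

lemma restricted_prob_approx:
  assumes t: "0 \<le> t" and K: "1 - e \<le> measure (M x) {\<omega> \<in> space (M x). set (lattice_path (t / real N) N \<omega>) \<subseteq> K}"
    and N: "0 < N"
  shows "\<bar>p t x z - restricted_prob K (t / real N) N x z\<bar> \<le> e"
proof -
  interpret prob_space "M x" by (rule prob_space_M)
  let ?A = "{\<omega> \<in> space (M x). set (lattice_path (t / real N) N \<omega>) \<subseteq> K}"
  let ?B = "{\<omega> \<in> space (M x). X t \<omega> = z}"
  have sets: "?A \<in> sets (M x)" "?B \<in> sets (M x)"
    using t by (auto intro!: sets_lattice_path sets_X_pred)
  have "restricted_prob K (t / real N) N x z = prob (?A \<inter> ?B)"
    unfolding restricted_prob_def using N by (intro arg_cong[where f=prob]) auto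
  moreover have "prob (?A \<inter> ?B) \<le> prob ?B" using sets by (intro finite_measure_mono) auto
  moreover have "prob ?B \<le> prob (?A \<inter> ?B) + prob (space (M x) - ?A)"
  proof -
    have "prob ?B \<le> prob ((?A \<inter> ?B) \<union> (space (M x) - ?A))"
      using sets by (intro finite_measure_mono) auto
    also have "\<dots> \<le> prob (?A \<inter> ?B) + prob (space (M x) - ?A)"
      using sets by (intro measure_Un_le) auto
    finally show ?thesis .
  qed
  moreover have "prob (space (M x) - ?A) = 1 - prob ?A" using sets by (intro prob_compl)
  ultimately show ?thesis using K by (simp add: trans_prob_def)
qed

section \<open>Positivity of transition probabilities\<close>

lemma p_tendsto_0: "((\<lambda>h. p h x z) \<longlongrightarrow> of_bool (x = z)) (at_right 0)"
  using DERIV_continuous[OF p_deriv[of x z]]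
  by (simp add: continuous_within at_within_Ici_at_right p_0)

text \<open>Continuity at 0 gives positivity for all short times, and \<open>t\<close> is cut into
  \<open>N\<close> equal short pieces.\<close>

lemma p_same_pos:
  assumes "0 \<le> t"
  shows "0 < p t x x"
proof -
  have "\<forall>\<^sub>F h in at_right 0. 0 < p h x x"
    using p_tendsto_0[of x x] by (rule order_tendstoD) simp
  then obtain b where b: "0 < b" "\<And>h. 0 < h \<Longrightarrow> h < b \<Longrightarrow> 0 < p h x x"
    unfolding eventually_at_right_field by blast
  obtain N where N: "t < real N * b" using reals_Archimedean3[OF b(1)] by blast
  then have "0 < real N" using assms b(1) by (cases N) auto
  define h where "h = t / real N"
  have h: "0 \<le> h" "h < b" "real N * h = t"
    using N assms \<open>0 < real N\<close> by (auto simp: h_def field_simps)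
  have "0 < p (real k * h) x x" for k
  proof (induction k)
    case (Suc k)
    have "0 < p h x x" using b(2)[of h] h by (cases "h = 0") (auto simp: p_0)
    then have "0 < p (real k * h) x x * p h x x" using Suc by simp
    also have "\<dots> \<le> p (real k * h + h) x x" using h by (intro p_mult_le) auto
    finally show ?case by (simp add: algebra_simps)
  qed (simp add: p_0)
  from this[of N] h(3) show ?thesis by simp
qed

text \<open>Jump within a short time \<open>h\<close>, where the positive derivative forces
  positivity, and be found at \<open>z\<close> again after the remaining
  \<open>t - h\<close>.\<close>

lemma p_pos_of_rate:
  assumes "x \<noteq> z" "0 < R x z" "0 < t"
  shows "0 < p t x z"
proof -
  have "\<forall>\<^sub>F h in at_right 0. 0 < (p h x z - of_bool (x = z)) / h"
    using p_quotient_limit[of x z] assms by (intro order_tendstoD) auto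
  then obtain b where b: "0 < b" "\<And>h. 0 < h \<Longrightarrow> h < b \<Longrightarrow> 0 < p h x z / h"
    unfolding eventually_at_right_field using assms(1) by auto
  define h where "h = min t (b / 2)"
  have h: "0 < h" "h < b" "h \<le> t" using assms b(1) by (auto simp: h_def)
  have "0 < p h x z" using b(2)[OF h(1,2)] h by (simp add: zero_less_divide_iff)
  then have "0 < p h x z * p (t - h) z z" using p_same_pos[of "t - h" z] h by simp
  also have "\<dots> \<le> p (h + (t - h)) x z" using h by (intro p_mult_le) auto
  finally show ?thesis by simp
qed

lemma p_pos_step:
  assumes "x \<noteq> w" "0 < R x w" "\<And>t. 0 < t \<Longrightarrow> 0 < p t w z" "0 < t"
  shows "0 < p t x z"
proof -
  have "0 < p (t/2) x w * p (t/2) w z" using p_pos_of_rate[OF assms(1,2)] assms(3,4) by simp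
  also have "\<dots> \<le> p (t/2 + t/2) x z" using assms by (intro p_mult_le) auto
  finally show ?thesis by simp
qed

lemma finite_dimensional_prob:
  fixes t :: "nat \<Rightarrow> real"
  assumes "0 \<le> t 0" "\<And>i. i < n \<Longrightarrow> t i \<le> t (Suc i)"
  shows "measure (M x) {\<omega> \<in> space (M x). \<forall>i\<le>n. X (t i) \<omega> = z i} =
    p (t 0) x (z 0) * (\<Prod>i<n. p (t (Suc i) - t i) (z i) (z (Suc i)))"
  using assms
proof (induction n)
  case (Suc n)
  then show ?case using markov_property[of t n x z] by (simp add: less_Suc_eq_le mult.assoc)
qed (simp add: trans_prob_def)

section \<open>Escape from finite sets and absorption\<close>

definition set_prob :: "real \<Rightarrow> 'x \<Rightarrow> 'x set \<Rightarrow> real" where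
  "set_prob t x A = measure (M x) {\<omega> \<in> space (M x). X t \<omega> \<in> A}"

lemma set_prob_nonneg: "0 \<le> set_prob t x A"
  and set_prob_le_1: "set_prob t x A \<le> 1"
  by (simp_all add: set_prob_def prob_space.prob_le_1[OF prob_space_M])

lemma set_prob_has_sum: "0 \<le> t \<Longrightarrow> (p t x has_sum set_prob t x A) A"
  unfolding set_prob_def by (rule p_has_sum)

lemma set_prob_has_sum_of_bool:
  assumes "0 \<le> t"
  shows "((\<lambda>z. p t x z * of_bool (z \<in> A)) has_sum set_prob t x A) UNIV"
proof -
  have "((\<lambda>z. p t x z * of_bool (z \<in> A)) has_sum set_prob t x A) UNIV \<longleftrightarrow>
    (p t x has_sum set_prob t x A) A" by (rule has_sum_cong_neutral) auto
  then show ?thesis using set_prob_has_sum[OF assms] by simp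
qed

lemma set_prob_chapman_kolmogorov:
  assumes "0 \<le> s" "0 \<le> t"
  shows "((\<lambda>w. p s x w * set_prob t w A) has_sum set_prob (s + t) x A) UNIV"
proof (rule has_sum_swap_nonneg)
  show "((\<lambda>w. p s x w * p t w z * of_bool (z \<in> A)) has_sum p (s + t) x z * of_bool (z \<in> A)) UNIV" for z
    by (intro has_sum_cmult_left chapman_kolmogorov assms)
  show "((\<lambda>z. p (s + t) x z * of_bool (z \<in> A)) has_sum set_prob (s + t) x A) UNIV"
    using assms by (intro set_prob_has_sum_of_bool) auto
  show "((\<lambda>z. p s x w * p t w z * of_bool (z \<in> A)) has_sum p s x w * set_prob t w A) UNIV" for w
    unfolding mult.assoc by (intro has_sum_cmult_right set_prob_has_sum_of_bool assms)
qed (simp add: p_nonneg)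

lemma set_prob_compl_le:
  assumes "0 \<le> t" "finite D" "D \<inter> A = {}"
  shows "set_prob t x A \<le> 1 - (\<Sum>z\<in>D. p t x z)"
proof -
  have "(p t x has_sum (set_prob t x A + (\<Sum>z\<in>D. p t x z))) (A \<union> D)"
    using assms by (intro has_sum_Un_disjoint set_prob_has_sum) (auto simp: has_sum_finite_iff)
  then have "set_prob t x A + (\<Sum>z\<in>D. p t x z) \<le> 1"
    by (rule has_sum_mono2[OF _ p_sum_1[OF assms(1)]]) (auto simp: p_nonneg)
  then show ?thesis by simp
qed

lemma set_prob_eq_0:
  assumes "0 \<le> t" "\<And>z. z \<in> A \<Longrightarrow> p t x z = 0"
  shows "set_prob t x A = 0"
  using set_prob_has_sum[OF assms(1), of x A] has_sum_0[of A "p t x"] assms(2)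
  by (metis has_sum_unique)

text \<open>
  In \<open>N\<close> steps of length \<open>t / N\<close> the probability to leave \<open>F \<union> C\<close> is at most \<open>N o(1/N)\<close>,
  uniformly on \<open>F\<close> because \<open>F\<close> is finite.
\<close>

lemma set_prob_outside_eq_0:
  assumes F: "finite F"
    and closed: "\<And>x z t. x \<in> C \<Longrightarrow> z \<notin> C \<Longrightarrow> 0 \<le> t \<Longrightarrow> p t x z = 0"
    and exits: "\<And>x. x \<in> F \<Longrightarrow> \<exists>D. finite D \<and> x \<in> D \<and> D \<subseteq> F \<union> C \<and> (\<Sum>w\<in>D. R x w) = 0"
    and t: "0 < t" and x: "x \<in> F"
  shows "set_prob t x (- (F \<union> C)) = 0"
proof -
  let ?A = "- (F \<union> C)"
  define err where "err h = (\<Sum>x\<in>F. set_prob h x ?A)" for h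
  have C_0: "set_prob h w ?A = 0" if "w \<in> C" "0 \<le> h" for h w
    using that closed by (intro set_prob_eq_0) auto
  \<comment> \<open>Decompose at the first step: it escapes with probability at most
    \<open>err h\<close>; from a state of \<open>F\<close> the induction hypothesis applies, and
    from \<open>C\<close> nothing escapes.\<close>
  have step: "set_prob (real k * h) w ?A \<le> real k * err h" if "0 \<le> h" "w \<in> F" for k h w
    using that(2)
  proof (induction k arbitrary: w)
    case 0
    then show ?case by (subst set_prob_eq_0) (auto simp: p_0)
  next
    case (Suc k)
    have "((\<lambda>v. p h w v * set_prob (real k * h) v ?A) has_sum set_prob (h + real k * h) w ?A) UNIV"
      using that(1) by (intro set_prob_chapman_kolmogorov) auto
    moreover have "((\<lambda>v. p h w v * (real k * err h) + p h w v * of_bool (v \<in> ?A))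
        has_sum (1 * (real k * err h) + set_prob h w ?A)) UNIV"
      using that(1) by (intro has_sum_add has_sum_cmult_left p_sum_1 set_prob_has_sum_of_bool)
    ultimately have "set_prob (h + real k * h) w ?A \<le> 1 * (real k * err h) + set_prob h w ?A"
    proof (rule has_sum_mono)
      fix v
      have "set_prob (real k * h) v ?A \<le> real k * err h + of_bool (v \<in> ?A)"
      proof (cases "v \<in> F \<or> v \<in> C")
        case True
        then show ?thesis
          using Suc.IH[of v] C_0[of v "real k * h"] that(1)
          by (auto simp: err_def set_prob_nonneg sum_nonneg)
      next
        case False
        have "0 \<le> real k * err h" by (simp add: err_def set_prob_nonneg sum_nonneg)
        then show ?thesis using False set_prob_le_1[of "real k * h" v ?A] by (simp add: add_increasing)
      qed
      then show "p h w v * set_prob (real k * h) v ?A \<le> p h w v * (real k * err h) + p h w v * of_bool (v \<in> ?A)"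
        unfolding distrib_left[symmetric] by (intro mult_left_mono p_nonneg)
    qed
    moreover have "set_prob h w ?A \<le> err h"
      unfolding err_def using Suc.prems F by (intro member_le_sum) (auto simp: set_prob_nonneg)
    ultimately show ?case by (simp add: algebra_simps)
  qed
  have "((\<lambda>h. set_prob h x ?A / h) \<longlongrightarrow> 0) (at_right 0)" if "x \<in> F" for x
  proof -
    obtain D where D: "finite D" "x \<in> D" "D \<subseteq> F \<union> C" "(\<Sum>w\<in>D. R x w) = 0"
      using exits[OF \<open>x \<in> F\<close>] by blast
    \<comment> \<open>The rates sum to zero over \<open>D\<close>, so the mass missing from
      \<open>D\<close> at time \<open>h\<close> is \<open>o(h)\<close>.\<close>
    have "((\<lambda>h. - (\<Sum>w\<in>D. (p h x w - of_bool (x = w)) / h)) \<longlongrightarrow> - (\<Sum>w\<in>D. R x w)) (at_right 0)"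
      by (intro tendsto_minus tendsto_sum p_quotient_limit)
    then have lim: "((\<lambda>h. - (\<Sum>w\<in>D. (p h x w - of_bool (x = w)) / h)) \<longlongrightarrow> 0) (at_right 0)"
      using D by simp
    have le: "set_prob h x ?A / h \<le> - (\<Sum>w\<in>D. (p h x w - of_bool (x = w)) / h)" if "0 < h" for h
    proof -
      have "(\<Sum>w\<in>D. of_bool (x = w)) = (\<Sum>w\<in>D. if x = w then 1 else 0 :: real)"
        by (intro sum.cong) auto
      also have "\<dots> = 1" using D by simp
      finally have "- (\<Sum>w\<in>D. (p h x w - of_bool (x = w)) / h) = (1 - (\<Sum>w\<in>D. p h x w)) / h"
        by (simp add: sum_divide_distrib[symmetric] sum_subtractf minus_divide_left)
      moreover have "set_prob h x ?A \<le> 1 - (\<Sum>w\<in>D. p h x w)"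
        using that D by (intro set_prob_compl_le) auto
      ultimately show ?thesis using that by (simp add: divide_right_mono)
    qed
    show ?thesis
    proof (rule tendsto_sandwich[OF _ _ tendsto_const lim])
      show "\<forall>\<^sub>F h in at_right 0. 0 \<le> set_prob h x ?A / h"
        by (auto simp: eventually_at_right_field set_prob_nonneg intro!: exI[of _ 1])
      show "\<forall>\<^sub>F h in at_right 0. set_prob h x ?A / h \<le> - (\<Sum>w\<in>D. (p h x w - of_bool (x = w)) / h)"
        using le by (auto simp: eventually_at_right_field intro!: exI[of _ 1])
    qed
  qed
  then have "((\<lambda>h. \<Sum>x\<in>F. set_prob h x ?A / h) \<longlongrightarrow> (\<Sum>x\<in>F. 0)) (at_right 0)"
    by (intro tendsto_sum)
  then have "((\<lambda>h. err h / h) \<longlongrightarrow> 0) (at_right 0)" by (simp add: err_def sum_divide_distrib)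
  moreover have "filterlim (\<lambda>N. t / real N) (at_right 0) sequentially"
    unfolding filterlim_at using t
    by (auto intro!: lim_const_over_n eventually_mono[OF eventually_gt_at_top[of 0]])
  ultimately have "(\<lambda>N. err (t / real N) / (t / real N)) \<longlonglongrightarrow> 0" by (rule filterlim_compose)
  then have "(\<lambda>N. t * (err (t / real N) / (t / real N))) \<longlonglongrightarrow> t * 0" by (intro tendsto_mult tendsto_const)
  then have "set_prob t x ?A \<le> t * 0"
  proof (rule tendsto_lowerbound)
    show "\<forall>\<^sub>F N in sequentially. set_prob t x ?A \<le> t * (err (t / real N) / (t / real N))"
      using eventually_gt_at_top[of 0]
    proof eventually_elim
      case (elim N)
      then show ?case using step[of "t / real N" x N] t x by (simp add: field_simps)
    qed
  qed simp
  then show ?thesis using set_prob_nonneg[of t x ?A] by simp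
qed

text \<open>Started in \<open>F\<close>, the process is at a fixed time almost surely in
  \<open>F\<close> or \<open>C\<close>, and \<open>C\<close> is never left. From each of the
  finitely many states of \<open>F\<close> it is in \<open>C\<close> one time unit later with
  probability at least \<open>1 - r > 0\<close>, so being outside \<open>C\<close> at time
  \<open>k\<close> has probability at most \<open>r ^ k\<close>.\<close>

lemma AE_absorbed:
  assumes F: "finite F"
    and closed: "\<And>x z t. x \<in> C \<Longrightarrow> z \<notin> C \<Longrightarrow> 0 \<le> t \<Longrightarrow> p t x z = 0"
    and exits: "\<And>x. x \<in> F \<Longrightarrow> \<exists>D. finite D \<and> x \<in> D \<and> D \<subseteq> F \<union> C \<and> (\<Sum>w\<in>D. R x w) = 0"
    and z0: "z0 \<in> C" and reach: "\<And>x. x \<in> F \<Longrightarrow> 0 < p 1 x z0"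
    and x: "x \<in> F"
  shows "AE \<omega> in M x. \<exists>t\<ge>0. X t \<omega> \<in> C"
proof -
  define r where "r = Max ((\<lambda>x. set_prob 1 x (- C)) ` F)"
  have r_ge: "set_prob 1 w (- C) \<le> r" if "w \<in> F" for w
    using that F by (auto simp: r_def)
  have "r \<in> (\<lambda>x. set_prob 1 x (- C)) ` F" unfolding r_def using F x by (intro Max_in) auto
  then obtain u where u: "u \<in> F" "r = set_prob 1 u (- C)" by blast
  then have r: "0 \<le> r" "r < 1"
    using set_prob_compl_le[of 1 "{z0}" "- C" u] reach[of u] z0 by (auto simp: set_prob_nonneg)
  have geometric: "set_prob (real k) w (- C) \<le> r ^ k" if "w \<in> F" for k w
    using that
  proof (induction k arbitrary: w)
    case 0
    then show ?case by (simp add: set_prob_le_1)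
  next
    case (Suc k)
    have "((\<lambda>v. p 1 w v * set_prob (real k) v (- C)) has_sum set_prob (1 + real k) w (- C)) UNIV"
      by (intro set_prob_chapman_kolmogorov) auto
    moreover have "((\<lambda>v. p 1 w v * of_bool (v \<in> - C) * r ^ k) has_sum (set_prob 1 w (- C) * r ^ k)) UNIV"
      by (intro has_sum_cmult_left set_prob_has_sum_of_bool) simp
    ultimately have "set_prob (1 + real k) w (- C) \<le> set_prob 1 w (- C) * r ^ k"
    proof (rule has_sum_mono)
      fix v
      show "p 1 w v * set_prob (real k) v (- C) \<le> p 1 w v * of_bool (v \<in> - C) * r ^ k"
      proof (cases "v \<in> C")
        case True
        then show ?thesis using closed by (subst set_prob_eq_0) auto
      next
        case False
        show ?thesis
        proof (cases "v \<in> F")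
          case True
          then show ?thesis using False Suc.IH[of v] by (auto intro!: mult_left_mono p_nonneg)
        next
          case nF: False
          have "(p 1 w has_sum 0) (- (F \<union> C))"
            using set_prob_has_sum[of 1 w "- (F \<union> C)"]
              set_prob_outside_eq_0[OF F closed exits, of 1 w] Suc.prems by simp
          then have "p 1 w v = 0" using nF False
            by (intro nonneg_has_sum_le_0D[of "p 1 w" "- (F \<union> C)" 0]) (auto simp: p_nonneg)
          then show ?thesis by simp
        qed
      qed
    qed
    also have "\<dots> \<le> r * r ^ k" using r_ge[OF Suc.prems] r by (intro mult_right_mono) auto
    finally show ?case by (simp add: add.commute)
  qed
  interpret prob_space "M x" by (rule prob_space_M)
  define E where "E = {\<omega> \<in> space (M x). \<forall>k. X (real k) \<omega> \<in> - C}"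
  have E: "E \<in> sets (M x)"
  proof -
    have "E = (\<Inter>k. {\<omega> \<in> space (M x). X (real k) \<omega> \<in> - C})" by (auto simp: E_def)
    also have "\<dots> \<in> sets (M x)" using sets_X[of _ x "- C"] by (intro sets.countable_INT') auto
    finally show ?thesis .
  qed
  have "prob E \<le> r ^ k" for k
  proof -
    have "prob E \<le> set_prob (real k) x (- C)"
      unfolding set_prob_def by (intro finite_measure_mono sets_X) (auto simp: E_def)
    then show ?thesis using geometric[OF x, of k] by simp
  qed
  then have "prob E \<le> 0"
    by (intro tendsto_lowerbound[OF LIMSEQ_power_zero[of r]]) (use r in auto)
  then have "prob E = 0" by (simp add: measure_le_0_iff)
  then have "emeasure (M x) E = 0" by (simp add: emeasure_eq_measure)
  then show ?thesis
    using E by (intro AE_I[of _ _ E]) (auto simp: E_def)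
qed

section \<open>Return times seen at integer times\<close>

lemma return_time_le:
  assumes "X (real s) \<omega> \<noteq> x" "X (real t) \<omega> = x" "s < t"
  shows "return_time X x \<omega> \<le> ennreal (real t)"
  unfolding return_time_def using assms
  by (intro Inf_lower CollectI exI[of _ "real t"] conjI exI[of _ "real s"]) auto

text \<open>
  Applied to the path at the times \<open>0, \<dots>, k\<close>, with \<open>m\<close> the first time away from \<open>x\<close>. Any
  \<open>m > k\<close> serves if the path has not left \<open>x\<close>.
\<close>

definition not_returned :: "'x \<Rightarrow> nat \<Rightarrow> 'x list \<Rightarrow> bool" where
  "not_returned x k l \<longleftrightarrow> (\<exists>m\<ge>1. \<forall>i\<le>k. l ! i = x \<longleftrightarrow> i < m)"

text \<open>A return seen at integer times cannot precede the true one, so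
  \<open>return_time\<close> is at most the first \<open>k\<close> at which
  \<open>not_returned\<close> fails. Every \<open>j < k\<close> contributes 1 to the series; if
  \<open>not_returned\<close> never fails, the series is infinite.\<close>

lemma return_time_le_suminf:
  assumes "X 0 \<omega> = x"
  shows "return_time X x \<omega> \<le> (\<Sum>k. of_bool (not_returned x k (lattice_path 1 k \<omega>)))"
proof (cases "\<exists>k. \<not> not_returned x k (lattice_path 1 k \<omega>)")
  case True
  define k where "k = (LEAST k. \<not> not_returned x k (lattice_path 1 k \<omega>))"
  have k: "\<not> not_returned x k (lattice_path 1 k \<omega>)" unfolding k_def using True by (rule LeastI_ex)
  have before: "not_returned x j (lattice_path 1 j \<omega>)" if "j < k" for j
    using not_less_Least[of j] that unfolding k_def by blast
  have ex: "\<exists>m. m \<le> k \<and> X (real m) \<omega> \<noteq> x"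
  proof (rule ccontr)
    assume "\<not> ?thesis"
    then have "not_returned x k (lattice_path 1 k \<omega>)"
      by (auto simp: not_returned_def intro!: exI[of _ "Suc k"])
    then show False using k by simp
  qed
  define m where "m = (LEAST m. m \<le> k \<and> X (real m) \<omega> \<noteq> x)"
  have m: "m \<le> k" "X (real m) \<omega> \<noteq> x" using LeastI_ex[OF ex] by (auto simp: m_def)
  have m_least: "X (real i) \<omega> = x" if "i < m" for i
    using not_less_Least[of i "\<lambda>m. m \<le> k \<and> X (real m) \<omega> \<noteq> x"] that m(1) by (auto simp: m_def)
  \<comment> \<open>The path starts at \<open>x\<close>, so its first observed time away from
    \<open>x\<close> is not 0, as \<open>not_returned\<close> demands.\<close>
  have "m \<ge> 1" using m assms by (cases m) auto
  with k have "\<exists>i\<le>k. (X (real i) \<omega> = x) \<noteq> (i < m)"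
    by (auto simp: not_returned_def)
  then obtain i where i: "i \<le> k" "X (real i) \<omega> = x" "m \<le> i" using m_least by (metis not_less)
  then have "m < i" using m(2) by (cases "m = i") auto
  then have "return_time X x \<omega> \<le> ennreal (real i)" using return_time_le[OF m(2) i(2)] by simp
  also have "\<dots> \<le> ennreal (real k)" using i(1) by (intro ennreal_leI) simp
  also have "\<dots> = (\<Sum>j<k. of_bool (not_returned x j (lattice_path 1 j \<omega>)))"
    using before by (simp add: ennreal_of_nat_eq_real_of_nat)
  also have "\<dots> \<le> (\<Sum>k. of_bool (not_returned x k (lattice_path 1 k \<omega>)))"
    by (intro sum_le_suminf summableI) auto
  finally show ?thesis .
next
  case False
  have "of_nat N \<le> (\<Sum>k. of_bool (not_returned x k (lattice_path 1 k \<omega>)) :: ennreal)" for N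
  proof -
    have "of_nat N = (\<Sum>k<N. of_bool (not_returned x k (lattice_path 1 k \<omega>)) :: ennreal)"
      using False by simp
    also have "\<dots> \<le> (\<Sum>k. of_bool (not_returned x k (lattice_path 1 k \<omega>)))"
      by (intro sum_le_suminf summableI) auto
    finally show ?thesis .
  qed
  then have "(\<Sum>k. of_bool (not_returned x k (lattice_path 1 k \<omega>)) :: ennreal) = \<top>"
    by (metis ennreal_Ex_less_of_nat leD top.not_eq_extremum)
  then show ?thesis by simp
qed

end

section \<open>Reversible jump processes\<close>

locale reversible_jump_process = jump_process M X R
  for M :: "'x \<Rightarrow> 'w measure" and X :: "real \<Rightarrow> 'w \<Rightarrow> 'x" and R :: "'x \<Rightarrow> 'x \<Rightarrow> real" +
  fixes \<pi> :: "'x \<Rightarrow> real"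
  assumes pi_nonneg: "0 \<le> \<pi> x" and pi_sum: "(\<pi> has_sum 1) UNIV"
    and R_detailed_balance: "\<pi> x * R x z = \<pi> z * R z x"
begin

text \<open>
  Up to a small probability the path on \<open>[0,t]\<close> stays in a finite set \<open>K\<close>, since it is a step
  function. Observed at the times \<open>i t / N\<close> and killed outside \<open>K\<close>, the process has as transition
  matrix a power of the \<open>K\<close>-block of \<open>p (t/N)\<close>, which is within \<open>N o(1/N)\<close> of the corresponding power
  of \<open>1 + (t/N) R\<close>; the latter is exactly symmetric with respect to \<open>\<pi>\<close>.
\<close>

lemma p_detailed_balance:
  assumes "0 \<le> t"
  shows "\<pi> x * p t x z = \<pi> z * p t z x"
proof (cases "t = 0")
  case True
  then show ?thesis by (simp add: p_0)
next
  case False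
  then have t: "0 < t" using assms by simp
  have "\<bar>\<pi> x * p t x z - \<pi> z * p t z x\<bar> \<le> 0 + e" if e: "0 < e" for e
  proof -
    \<comment> \<open>Each of the two probabilities is off by at most \<open>2 * d\<close>:
      \<open>d\<close> for paths leaving \<open>K\<close>, \<open>d\<close> for replacing
      \<open>p h\<close> by \<open>1 + h R\<close>. The \<open>+ 1\<close> keeps the denominator
      positive when both weights vanish.\<close>
    define d where "d = e / (2 * (\<pi> x + \<pi> z + 1))"
    have d: "0 < d" "(\<pi> x + \<pi> z) * (2 * d) \<le> e"
      using e pi_nonneg[of x] pi_nonneg[of z] by (auto simp: d_def field_simps add_nonneg_pos)
    obtain K1 where K1: "finite K1" "\<And>K N. K1 \<subseteq> K \<Longrightarrow>
        1 - d \<le> measure (M x) {\<omega> \<in> space (M x). set (lattice_path (t / real N) N \<omega>) \<subseteq> K}"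
      using paths_in_finite_set[OF assms d(1), of x] by blast
    obtain K2 where K2: "finite K2" "\<And>K N. K2 \<subseteq> K \<Longrightarrow>
        1 - d \<le> measure (M z) {\<omega> \<in> space (M z). set (lattice_path (t / real N) N \<omega>) \<subseteq> K}"
      using paths_in_finite_set[OF assms d(1), of z] by blast
    \<comment> \<open>One \<open>K\<close> for both starting points, since symmetry compares entries
      of the same matrix.\<close>
    define K where "K = K1 \<union> K2 \<union> {x, z}"
    have K: "finite K" "x \<in> K" "z \<in> K" "K1 \<subseteq> K" "K2 \<subseteq> K" using K1 K2 by (auto simp: K_def)
    define B where "B h w v = of_bool (w = v) + h * R w v" for h w v
    define err where "err h = (\<Sum>w\<in>K. \<Sum>v\<in>K. \<bar>(p h w v - of_bool (w = v)) / h - R w v\<bar>)" for h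
    have "(err \<longlongrightarrow> (\<Sum>w\<in>K. \<Sum>v\<in>K. \<bar>R w v - R w v\<bar>)) (at_right 0)"
      unfolding err_def by (intro tendsto_sum tendsto_rabs tendsto_diff p_quotient_limit tendsto_const)
    then have "(err \<longlongrightarrow> 0) (at_right 0)" by simp
    moreover have lim: "filterlim (\<lambda>N. t / real N) (at_right 0) sequentially"
      unfolding filterlim_at using t
      by (auto intro!: lim_const_over_n eventually_mono[OF eventually_gt_at_top[of 0]])
    ultimately have "(\<lambda>N. err (t / real N)) \<longlonglongrightarrow> 0" by (rule filterlim_compose)
    then have "(\<lambda>N. t * err (t / real N)) \<longlonglongrightarrow> t * 0" by (intro tendsto_mult tendsto_const)
    then have ev1: "\<forall>\<^sub>F N in sequentially. t * err (t / real N) < d"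
      using d(1) by (intro order_tendstoD) auto
    \<comment> \<open>The diagonal of \<open>1 + h R\<close> is nonnegative once \<open>h\<close> is
      small against the exit rates, of which the block has finitely many.\<close>
    have "\<forall>\<^sub>F h in at_right 0. \<forall>w\<in>K. 0 \<le> 1 + h * R w w"
    proof (intro eventually_ball_finite ballI K(1))
      fix w
      have "((\<lambda>h. 1 + h * R w w) \<longlongrightarrow> 1 + 0 * R w w) (at_right 0)" by (intro tendsto_intros)
      then have "\<forall>\<^sub>F h in at_right 0. 0 < 1 + h * R w w" by (rule order_tendstoD) simp
      then show "\<forall>\<^sub>F h in at_right 0. 0 \<le> 1 + h * R w w" by eventually_elim simp
    qed
    with lim have ev2: "\<forall>\<^sub>F N in sequentially. \<forall>w\<in>K. 0 \<le> 1 + t / real N * R w w"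
      unfolding filterlim_iff by blast
    have "\<forall>\<^sub>F N in sequentially. 0 < N \<and> t * err (t / real N) < d \<and> (\<forall>w\<in>K. 0 \<le> 1 + t / real N * R w w)"
      using eventually_gt_at_top[of 0] ev1 ev2 by (intro eventually_conj)
    from eventually_happens'[OF sequentially_bot this]
    obtain N where N: "0 < N" "t * err (t / real N) < d" "\<forall>w\<in>K. 0 \<le> 1 + t / real N * R w w"
      by (elim exE conjE) (rule that)
    define h where "h = t / real N"
    have h: "0 < h" using t N by (simp add: h_def)
    have diag: "0 \<le> 1 + h * R w w" if "w \<in> K" for w using N(3) that by (simp add: h_def)
    have B_nonneg: "0 \<le> B h w v" if "w \<in> K" "v \<in> K" for w v
      using diag[of w] that R_nonneg[of w v] h by (cases "w = v") (auto simp: B_def)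
    have B_row: "(\<Sum>v\<in>K. B h w v) \<le> 1" if "w \<in> K" for w
    proof -
      have "(\<Sum>v\<in>K. of_bool (w = v)) = (\<Sum>v\<in>K. if w = v then 1 else 0 :: real)"
        by (intro sum.cong) auto
      also have "\<dots> = 1" using K that by simp
      finally show ?thesis using R_row_sum_le_0[OF K(1) that] h
        by (simp add: B_def sum.distrib sum_distrib_left[symmetric] mult_le_0_iff)
    qed
    \<comment> \<open>Each entry is off by \<open>h\<close> times a vanishing quantity, and
      \<open>N\<close> steps with \<open>N h = t\<close> accumulate
      \<open>t * err h\<close>.\<close>
    have err: "real N * (\<Sum>w\<in>K. \<Sum>v\<in>K. \<bar>p h w v - B h w v\<bar>) < d"
    proof -
      have "\<bar>p h w v - B h w v\<bar> = h * \<bar>(p h w v - of_bool (w = v)) / h - R w v\<bar>" for w v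
      proof -
        have "p h w v - B h w v = h * ((p h w v - of_bool (w = v)) / h - R w v)"
          using h by (simp add: B_def field_simps)
        then show ?thesis using h by (simp add: abs_mult)
      qed
      then have "real N * (\<Sum>w\<in>K. \<Sum>v\<in>K. \<bar>p h w v - B h w v\<bar>) = real N * h * err h"
        by (simp add: err_def sum_distrib_left mult.assoc)
      then show ?thesis using N by (simp add: h_def)
    qed
    have approx: "\<bar>p t u v - sub_power K (B h) N u v\<bar> \<le> 2 * d"
      if "u \<in> K" "v \<in> K" and close: "1 - d \<le> measure (M u) {\<omega> \<in> space (M u). set (lattice_path (t / real N) N \<omega>) \<subseteq> K}"
      for u v
    proof -
      have "(\<Sum>v\<in>K. \<bar>restricted_prob K h N u v - sub_power K (B h) N u v\<bar>)
          \<le> real N * (\<Sum>w\<in>K. \<Sum>v\<in>K. \<bar>p h w v - B h w v\<bar>)"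
        using h B_nonneg B_row K by (intro sub_power_perturbation)
          (auto simp: restricted_prob_0 restricted_prob_Suc, auto simp: restricted_prob_def prob_space.prob_le_1[OF prob_space_M])
      moreover have "\<bar>restricted_prob K h N u v - sub_power K (B h) N u v\<bar> \<le>
          (\<Sum>v\<in>K. \<bar>restricted_prob K h N u v - sub_power K (B h) N u v\<bar>)"
        using that K by (intro member_le_sum) auto
      ultimately show ?thesis
        using err restricted_prob_approx[OF assms close N(1), of v] by (simp add: h_def)
    qed
    have "\<bar>p t x z - sub_power K (B h) N x z\<bar> \<le> 2 * d" "\<bar>p t z x - sub_power K (B h) N z x\<bar> \<le> 2 * d"
      using K1(2)[OF K(4)] K2(2)[OF K(5)] K by (auto intro!: approx)
    then have "\<bar>\<pi> x * (p t x z - sub_power K (B h) N x z)\<bar> \<le> \<pi> x * (2 * d)"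
        "\<bar>\<pi> z * (p t z x - sub_power K (B h) N z x)\<bar> \<le> \<pi> z * (2 * d)"
      using pi_nonneg by (auto simp: abs_mult intro!: mult_left_mono)
    moreover have "\<pi> x * sub_power K (B h) N x z = \<pi> z * sub_power K (B h) N z x"
      using K by (intro sub_power_symmetric)
        (use R_detailed_balance in \<open>auto simp: B_def algebra_simps\<close>)
    ultimately show ?thesis using d(2) by (simp add: algebra_simps abs_le_iff)
  qed
  then have "\<bar>\<pi> x * p t x z - \<pi> z * p t z x\<bar> \<le> 0" by (rule field_le_epsilon)
  then show ?thesis by simp
qed

lemma pi_stationary:
  assumes "0 \<le> t"
  shows "((\<lambda>x. \<pi> x * p t x z) has_sum \<pi> z) UNIV"
proof -
  have "((\<lambda>x. \<pi> z * p t z x) has_sum \<pi> z * 1) UNIV"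
    by (intro has_sum_cmult_right p_sum_1 assms)
  then show ?thesis by (simp add: p_detailed_balance[OF assms, of _ z])
qed

text \<open>By detailed balance the flow to \<open>z\<close> equals the flow back from
  \<open>z\<close>, which carries no mass. Thus the support of \<open>\<pi>\<close> is
  closed.\<close>

lemma p_eq_0_of_pi: "0 < \<pi> x \<Longrightarrow> \<pi> z = 0 \<Longrightarrow> 0 \<le> t \<Longrightarrow> p t x z = 0"
  using p_detailed_balance[of t x z] by simp

lemma stationary_distribution_pi: "stationary_distribution M X \<pi>"
  unfolding stationary_distribution_def using pi_nonneg pi_sum pi_stationary by blast

text \<open>
  If \<open>q\<close> is stationary then so is \<open>min q \<pi>\<close>, because it has the same total mass as its image.
  At \<open>z0\<close> it coincides with \<open>q\<close> or with \<open>\<pi>\<close>, hence everywhere, as \<open>z0\<close> is reached from every state.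
\<close>

lemma stationary_distribution_unique:
  assumes reach: "\<And>x. 0 < p 1 x z0" and q: "stationary_distribution M X q"
  shows "q = \<pi>"
proof -
  have q_nonneg: "\<And>x. 0 \<le> q x" and q_sum: "(q has_sum 1) UNIV"
    and q_stat: "\<And>z. ((\<lambda>x. q x * p 1 x z) has_sum q z) UNIV"
    using q by (auto simp: stationary_distribution_def)
  define m where "m x = min (q x) (\<pi> x)" for x
  have m_le: "m x \<le> q x" "m x \<le> \<pi> x" and m_nonneg: "0 \<le> m x" for x
    using q_nonneg[of x] pi_nonneg[of x] by (auto simp: m_def)
  obtain s where s: "(m has_sum s) UNIV"
    using summable_on_comparison_test[of \<pi> UNIV m] pi_sum m_le m_nonneg by (auto simp: summable_on_def)
  have "\<exists>h. ((\<lambda>x. m x * p 1 x z) has_sum h) UNIV" for z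
  proof -
    have "(\<lambda>x. m x * p 1 x z) summable_on UNIV"
    proof (rule summable_on_comparison_test)
      show "(\<lambda>x. \<pi> x * p 1 x z) summable_on UNIV" using pi_stationary[of 1 z] by (auto simp: summable_on_def)
    qed (auto intro!: mult_right_mono simp: m_le m_nonneg p_nonneg)
    then show ?thesis by (auto simp: summable_on_def)
  qed
  then obtain h where h: "\<And>z. ((\<lambda>x. m x * p 1 x z) has_sum h z) UNIV" by metis
  have h_le: "h z \<le> m z" for z
  proof -
    have "h z \<le> q z" by (rule has_sum_mono[OF h q_stat]) (auto intro!: mult_right_mono simp: m_le p_nonneg)
    moreover have "h z \<le> \<pi> z"
      by (rule has_sum_mono[OF h pi_stationary[of 1]]) (auto intro!: mult_right_mono simp: m_le p_nonneg)
    ultimately show ?thesis by (simp add: m_def)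
  qed
  have "(h has_sum s) UNIV"
  proof (rule has_sum_swap_nonneg)
    show "((\<lambda>z. m x * p 1 x z) has_sum m x) UNIV" for x
      using has_sum_cmult_right[OF p_sum_1[of 1 x], of "m x"] by simp
  qed (use h s m_nonneg p_nonneg in auto)
  then have "((\<lambda>z. m z - h z) has_sum (s - s)) UNIV" by (intro has_sum_diff s)
  then have h_eq: "h z = m z" for z
    using nonneg_has_sum_le_0D[of "\<lambda>z. m z - h z" UNIV 0 z] h_le by simp
  \<comment> \<open>The nonnegative differences \<open>u x - m x\<close>, weighted by the positive
    \<open>p 1 x z0\<close>, sum to \<open>u z0 - m z0 = 0\<close>.\<close>
  have key: "m = u" if u: "((\<lambda>x. u x * p 1 x z0) has_sum u z0) UNIV" "\<And>x. m x \<le> u x" "m z0 = u z0" for u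
  proof
    fix x
    have "((\<lambda>x. u x * p 1 x z0 - m x * p 1 x z0) has_sum (u z0 - h z0)) UNIV"
      by (intro has_sum_diff u h)
    then have "u x * p 1 x z0 - m x * p 1 x z0 = 0"
      by (rule nonneg_has_sum_le_0D) (auto intro!: mult_right_mono simp: u h_eq p_nonneg)
    then show "m x = u x" using reach[of x] by (simp add: left_diff_distrib[symmetric])
  qed
  \<comment> \<open>Equality with either distribution gives \<open>m\<close> total mass 1; lying
    below both, it then equals both.\<close>
  have "s = 1 \<and> (m = q \<or> m = \<pi>)"
  proof (cases "m z0 = q z0")
    case True
    then have "m = q" using m_le q_stat by (intro key) auto
    then show ?thesis using s q_sum by (metis has_sum_unique)
  next
    case False
    then have "m z0 = \<pi> z0" by (auto simp: m_def)
    then have "m = \<pi>" using m_le pi_stationary by (intro key) auto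
    then show ?thesis using s pi_sum by (metis has_sum_unique)
  qed
  then have s1: "(m has_sum 1) UNIV" using s by simp
  show ?thesis
  proof
    fix x
    have "((\<lambda>x. q x - m x) has_sum (1 - 1)) UNIV" "((\<lambda>x. \<pi> x - m x) has_sum (1 - 1)) UNIV"
      by (intro has_sum_diff s1 q_sum pi_sum)+
    then have "q x - m x = 0" "\<pi> x - m x = 0"
      using nonneg_has_sum_le_0D[of "\<lambda>x. q x - m x" UNIV 0 x]
        nonneg_has_sum_le_0D[of "\<lambda>x. \<pi> x - m x" UNIV 0 x] m_le by auto
    then show "q x = \<pi> x" by simp
  qed
qed

text \<open>Detailed balance moves \<open>\<pi>\<close> across one factor at a time, from the start
  of the path to its end.\<close>

lemma path_weight_reverse:
  assumes "\<And>i. i < n \<Longrightarrow> 0 \<le> d i"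
  shows "\<pi> (z 0) * (\<Prod>i<n. p (d i) (z i) (z (Suc i))) = \<pi> (z n) * (\<Prod>i<n. p (d i) (z (Suc i)) (z i))"
  using assms
proof (induction n)
  case (Suc n)
  then have "\<pi> (z 0) * (\<Prod>i<Suc n. p (d i) (z i) (z (Suc i))) =
      (\<pi> (z n) * p (d n) (z n) (z (Suc n))) * (\<Prod>i<n. p (d i) (z (Suc i)) (z i))"
    by (simp add: mult_ac)
  also have "\<dots> = \<pi> (z (Suc n)) * (\<Prod>i<Suc n. p (d i) (z (Suc i)) (z i))"
    using Suc.prems by (subst p_detailed_balance) (auto simp: mult_ac)
  finally show ?case .
qed simp

lemma stationary_path_prob:
  fixes t :: "nat \<Rightarrow> real"
  assumes "0 \<le> t 0" "\<And>i. i < n \<Longrightarrow> t i \<le> t (Suc i)"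
  shows "(\<Sum>\<^sub>\<infinity>x. \<pi> x * measure (M x) {\<omega> \<in> space (M x). \<forall>i\<le>n. X (t i) \<omega> = z i}) =
    \<pi> (z 0) * (\<Prod>i<n. p (t (Suc i) - t i) (z i) (z (Suc i)))"
proof (rule infsumI)
  have "((\<lambda>x. \<pi> x * p (t 0) x (z 0) * (\<Prod>i<n. p (t (Suc i) - t i) (z i) (z (Suc i))))
      has_sum (\<pi> (z 0) * (\<Prod>i<n. p (t (Suc i) - t i) (z i) (z (Suc i))))) UNIV"
    by (intro has_sum_cmult_left pi_stationary assms)
  then show "((\<lambda>x. \<pi> x * measure (M x) {\<omega> \<in> space (M x). \<forall>i\<le>n. X (t i) \<omega> = z i})
      has_sum (\<pi> (z 0) * (\<Prod>i<n. p (t (Suc i) - t i) (z i) (z (Suc i))))) UNIV"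
    using finite_dimensional_prob[of t n _ z, OF assms] by (simp add: mult.assoc)
qed

lemma reversible_process_pi: "reversible_process M X \<pi>"
  unfolding reversible_process_def
proof (intro allI impI)
  fix T n and t :: "nat \<Rightarrow> real" and z :: "nat \<Rightarrow> 'x"
  assume range: "\<forall>i<n. 0 \<le> t i \<and> t i \<le> T" and mono: "\<forall>i j. i \<le> j \<longrightarrow> j < n \<longrightarrow> t i \<le> t j"
  show "(\<Sum>\<^sub>\<infinity>x. \<pi> x * measure (M x) {\<omega> \<in> space (M x). \<forall>i<n. X (t i) \<omega> = z i}) =
    (\<Sum>\<^sub>\<infinity>x. \<pi> x * measure (M x) {\<omega> \<in> space (M x). \<forall>i<n. X (T - t i) \<omega> = z i})"
  proof (cases n)
    case (Suc m)
    \<comment> \<open>The times \<open>T - t i\<close> decrease in \<open>i\<close>; reversing the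
      index as well gives an increasing sequence, to which \<open>stationary_path_prob\<close>
      applies.\<close>
    define u where "u i = T - t (m - i)" for i
    define y where "y i = z (m - i)" for i
    have rev: "(\<forall>i<n. X (T - t i) \<omega> = z i) \<longleftrightarrow> (\<forall>i\<le>m. X (u i) \<omega> = y i)" for \<omega>
    proof safe
      fix i assume "\<forall>i\<le>m. X (u i) \<omega> = y i" "i < n"
      then have "X (u (m - i)) \<omega> = y (m - i)" by simp
      then show "X (T - t i) \<omega> = z i" using \<open>i < n\<close> Suc by (simp add: u_def y_def)
    qed (auto simp: u_def y_def Suc)
    have u: "0 \<le> u 0" "\<And>i. i < m \<Longrightarrow> u i \<le> u (Suc i)"
      using range mono Suc by (auto simp: u_def)
    have t: "0 \<le> t 0" "\<And>i. i < m \<Longrightarrow> t i \<le> t (Suc i)" using range mono Suc by auto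
    have "(\<Sum>\<^sub>\<infinity>x. \<pi> x * measure (M x) {\<omega> \<in> space (M x). \<forall>i<n. X (T - t i) \<omega> = z i}) =
      \<pi> (z m) * (\<Prod>i<m. p (u (Suc i) - u i) (y i) (y (Suc i)))"
      unfolding rev using stationary_path_prob[of u m y, OF u] by (simp add: y_def)
    also have "(\<Prod>i<m. p (u (Suc i) - u i) (y i) (y (Suc i))) =
        (\<Prod>i<m. (\<lambda>j. p (t (Suc j) - t j) (z (Suc j)) (z j)) (m - Suc i))"
      by (intro prod.cong) (auto simp: u_def y_def Suc_diff_Suc)
    also have "\<dots> = (\<Prod>i<m. p (t (Suc i) - t i) (z (Suc i)) (z i))" by (rule prod.nat_diff_reindex)
    also have "\<pi> (z m) * \<dots> = \<pi> (z 0) * (\<Prod>i<m. p (t (Suc i) - t i) (z i) (z (Suc i)))"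
      using t by (intro path_weight_reverse[symmetric]) auto
    also have "\<dots> = (\<Sum>\<^sub>\<infinity>x. \<pi> x * measure (M x) {\<omega> \<in> space (M x). \<forall>i<n. X (t i) \<omega> = z i})"
      using stationary_path_prob[of t m z, OF t] by (simp add: Suc less_Suc_eq_le)
    finally show ?thesis by simp
  qed simp
qed

text \<open>
  At integer times, let \<open>e k z\<close> be the probability to be at \<open>z\<close> at time \<open>k\<close> without having returned
  to \<open>x\<close>. Since \<open>\<pi>\<close> is invariant, the expected occupation \<open>\<Sum>k. e k z\<close> is dominated by a multiple
  of \<open>\<pi> z\<close>, and its total mass bounds the mean return time.
\<close>

lemma mean_return_time_finite:
  assumes pos: "0 < \<pi> x" and leave: "p 1 x x < 1"
  shows "(\<integral>\<^sup>+ \<omega>. return_time X x \<omega> \<partial>M x) < \<infinity>"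
proof -
  interpret prob_space "M x" by (rule prob_space_M)
  let ?Q = "\<lambda>k \<omega>. not_returned x k (lattice_path 1 k \<omega>)"
  define r where "r = p 1 x x"
  have r: "0 \<le> r" "r < 1" using leave by (auto simp: r_def p_nonneg)
  define e where "e k z = prob {\<omega> \<in> space (M x). ?Q k \<omega> \<and> X (real k) \<omega> = z}" for k z
  \<comment> \<open>Chosen so that \<open>c * \<pi> x = 1 / (1 - r)\<close>, the geometric bound for
    the occupation of \<open>x\<close> itself.\<close>
  define c where "c = 1 / (\<pi> x * (1 - r))"
  have c: "0 \<le> c" using pos r by (simp add: c_def)
  have e_0: "e 0 z = 0" if "z \<noteq> x" for z
  proof -
    have *: "{\<omega> \<in> space (M x). ?Q 0 \<omega> \<and> X (real 0) \<omega> = z} = {}"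
      using that by (auto simp: not_returned_def)
    show ?thesis unfolding e_def * by simp
  qed
  \<comment> \<open>Being at \<open>x\<close> without a return means never having been seen away
    from \<open>x\<close>, so each step costs a factor \<open>r\<close>.\<close>
  have e_Suc_same: "e (Suc k) x = e k x * r" for k
  proof -
    have *: "{\<omega> \<in> space (M x). ?Q (Suc k) \<omega> \<and> X (real (Suc k)) \<omega> = x} =
      {\<omega> \<in> space (M x). ?Q k \<omega> \<and> X (real k) \<omega> = x \<and> X (real (Suc k)) \<omega> = x}"
    proof (rule Collect_cong, rule conj_cong[OF refl], rule iffI)
      fix \<omega> assume "?Q (Suc k) \<omega> \<and> X (real (Suc k)) \<omega> = x"
      then obtain m where "m \<ge> 1" "\<And>i. i \<le> Suc k \<Longrightarrow> X (real i) \<omega> = x \<longleftrightarrow> i < m" "X (real (Suc k)) \<omega> = x"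
        by (auto simp: not_returned_def simp del: of_nat_Suc)
      then show "?Q k \<omega> \<and> X (real k) \<omega> = x \<and> X (real (Suc k)) \<omega> = x"
        by (auto simp: not_returned_def simp del: of_nat_Suc intro!: exI[of _ m])
    next
      fix \<omega> assume "?Q k \<omega> \<and> X (real k) \<omega> = x \<and> X (real (Suc k)) \<omega> = x"
      then obtain m where m: "m \<ge> 1" "\<And>i. i \<le> k \<Longrightarrow> X (real i) \<omega> = x \<longleftrightarrow> i < m"
          "X (real k) \<omega> = x" "X (real (Suc k)) \<omega> = x"
        by (auto simp: not_returned_def simp del: of_nat_Suc)
      then have "X (real i) \<omega> = x" if "i \<le> Suc k" for i
        using that m(2)[of i] m(2)[of k] by (cases "i = Suc k") auto
      then show "?Q (Suc k) \<omega> \<and> X (real (Suc k)) \<omega> = x"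
        by (auto simp: not_returned_def simp del: of_nat_Suc intro!: exI[of _ "Suc (Suc k)"])
    qed
    show ?thesis unfolding e_def *
      using markov_lattice[of 1 x "not_returned x k" k x x] by (simp add: r_def)
  qed
  have e_same: "e k x \<le> r ^ k" for k
  proof (induction k)
    case (Suc k)
    then show ?case using r mult_right_mono[of "e k x" "r ^ k" r] by (simp add: e_Suc_same mult.commute)
  qed (simp add: e_def)
  have e_Suc: "((\<lambda>w. e k w * p 1 w z) has_sum e (Suc k) z) UNIV" if z: "z \<noteq> x" for k z
  proof -
    have *: "{\<omega> \<in> space (M x). ?Q (Suc k) \<omega> \<and> X (real (Suc k)) \<omega> = z} =
      {\<omega> \<in> space (M x). ?Q k \<omega> \<and> X (real (Suc k)) \<omega> = z}"
    proof (rule Collect_cong, rule conj_cong[OF refl], rule iffI)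
      fix \<omega> assume "?Q (Suc k) \<omega> \<and> X (real (Suc k)) \<omega> = z"
      then show "?Q k \<omega> \<and> X (real (Suc k)) \<omega> = z"
        by (auto simp: not_returned_def simp del: of_nat_Suc)
    next
      fix \<omega> assume "?Q k \<omega> \<and> X (real (Suc k)) \<omega> = z"
      then obtain m where m: "m \<ge> 1" "\<And>i. i \<le> k \<Longrightarrow> X (real i) \<omega> = x \<longleftrightarrow> i < m" "X (real (Suc k)) \<omega> = z"
        by (auto simp: not_returned_def simp del: of_nat_Suc)
      \<comment> \<open>If the path is still at \<open>x\<close> at time \<open>k\<close>, then
        \<open>m\<close> may be any number beyond \<open>k\<close>; the exit is now seen at
        \<open>Suc k\<close>, because \<open>z\<close> differs from \<open>x\<close>.\<close>
      then have "X (real i) \<omega> = x \<longleftrightarrow> i < min m (Suc k)" if "i \<le> Suc k" for i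
        using that z by (cases "i = Suc k") auto
      then show "?Q (Suc k) \<omega> \<and> X (real (Suc k)) \<omega> = z"
        using m by (auto simp: not_returned_def simp del: of_nat_Suc intro!: exI[of _ "min m (Suc k)"])
    qed
    show ?thesis unfolding e_def *
      using markov_lattice_has_sum[of 1 x "not_returned x k" k z] by simp
  qed
  have bound_same: "(\<Sum>k<N. e k x) \<le> c * \<pi> x" for N
  proof -
    have "(\<Sum>k<N. e k x) \<le> (\<Sum>k<N. r ^ k)" by (intro sum_mono e_same)
    also have "\<dots> \<le> 1 / (1 - r)" using r by (simp add: sum_gp_strict divide_right_mono)
    also have "\<dots> = c * \<pi> x" using pos by (simp add: c_def)
    finally show ?thesis .
  qed
  \<comment> \<open>Induction for all \<open>z\<close> at once: away from \<open>x\<close>, the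
    occupation before \<open>Suc N\<close> is the occupation before \<open>N\<close> moved by one
    step of \<open>p 1\<close>, and \<open>c * \<pi>\<close> is invariant under that step.\<close>
  have bound: "(\<Sum>k<N. e k z) \<le> c * \<pi> z" for N z
  proof (induction N arbitrary: z)
    case 0
    then show ?case using c pi_nonneg by simp
  next
    case (Suc N)
    show ?case
    proof (cases "z = x")
      case True
      then show ?thesis using bound_same[of "Suc N"] by simp
    next
      case False
      have "((\<lambda>w. \<Sum>k<N. e k w * p 1 w z) has_sum (\<Sum>k<N. e (Suc k) z)) UNIV"
        by (intro has_sum_sum e_Suc False)
      moreover have "((\<lambda>w. c * (\<pi> w * p 1 w z)) has_sum (c * \<pi> z)) UNIV"
        by (intro has_sum_cmult_right pi_stationary) simp
      ultimately have "(\<Sum>k<N. e (Suc k) z) \<le> c * \<pi> z"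
      proof (rule has_sum_mono)
        fix w show "(\<Sum>k<N. e k w * p 1 w z) \<le> c * (\<pi> w * p 1 w z)"
          using mult_right_mono[OF Suc.IH p_nonneg, of w 1 w z] by (simp add: sum_distrib_right mult.assoc)
      qed
      then show ?thesis using e_0[OF False] by (simp add: sum.lessThan_Suc_shift del: sum.lessThan_Suc)
    qed
  qed
  have sets: "{\<omega> \<in> space (M x). ?Q k \<omega>} \<in> sets (M x)" for k by (intro sets_lattice_path) simp
  have total: "(\<Sum>k<N. prob {\<omega> \<in> space (M x). ?Q k \<omega>}) \<le> c" for N
  proof -
    have "((\<lambda>z. e k z) has_sum prob {\<omega> \<in> space (M x). ?Q k \<omega>}) UNIV" for k
      using prob_fiber_has_sum[OF prob_space_M measurable_X countable_states sets, of "real k" k UNIV]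
      by (simp add: e_def)
    then have "((\<lambda>z. \<Sum>k<N. e k z) has_sum (\<Sum>k<N. prob {\<omega> \<in> space (M x). ?Q k \<omega>})) UNIV"
      by (intro has_sum_sum)
    moreover have "((\<lambda>z. c * \<pi> z) has_sum (c * 1)) UNIV" by (intro has_sum_cmult_right pi_sum)
    ultimately have "(\<Sum>k<N. prob {\<omega> \<in> space (M x). ?Q k \<omega>}) \<le> c * 1"
      by (rule has_sum_mono) (rule bound)
    then show ?thesis by simp
  qed
  have "(\<integral>\<^sup>+ \<omega>. return_time X x \<omega> \<partial>M x) \<le> (\<integral>\<^sup>+ \<omega>. (\<Sum>k. of_bool (?Q k \<omega>)) \<partial>M x)"
    by (intro nn_integral_mono_AE eventually_mono[OF AE_X_0[of x]] return_time_le_suminf)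
  also have "\<dots> = (\<integral>\<^sup>+ \<omega>. (\<Sum>k. indicator {\<omega> \<in> space (M x). ?Q k \<omega>} \<omega>) \<partial>M x)"
    by (intro nn_integral_cong suminf_cong) (auto simp: indicator_def)
  also have "\<dots> = (\<Sum>k. \<integral>\<^sup>+ \<omega>. indicator {\<omega> \<in> space (M x). ?Q k \<omega>} \<omega> \<partial>M x)"
    using sets by (intro nn_integral_suminf) auto
  also have "\<dots> = (\<Sum>k. ennreal (prob {\<omega> \<in> space (M x). ?Q k \<omega>}))"
    using sets by (intro suminf_cong) (auto simp: emeasure_eq_measure)
  also have "\<dots> \<le> ennreal c"
    by (intro suminf_le_const summableI) (simp add: sum_ennreal total ennreal_leI)
  finally show ?thesis by (rule order.strict_trans1) simp
qed

text \<open>Every state leads to \<open>z0\<close>, so an essential state is accessible from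
  \<open>z0\<close> and lies in the closed support. Conversely, detailed balance reverses every
  positive transition out of a state of positive weight.\<close>

lemma essential_iff:
  assumes z0: "0 < \<pi> z0" and reach: "\<And>x t. 0 < t \<Longrightarrow> 0 < p t x z0"
  shows "essential M X x \<longleftrightarrow> 0 < \<pi> x"
proof
  assume ess: "essential M X x"
  have "accessible M X x z0" unfolding accessible_def using reach[of 1 x] by (intro exI[of _ 1]) auto
  then have "accessible M X z0 x" using ess by (simp add: essential_def)
  then show "0 < \<pi> x"
    using p_eq_0_of_pi[OF z0, of x] pi_nonneg[of x] unfolding accessible_def by fastforce
next
  assume pos: "0 < \<pi> x"
  show "essential M X x"
    unfolding essential_def
  proof (intro allI impI)
    fix z assume "accessible M X x z"
    then obtain t where t: "0 \<le> t" "0 < p t x z" by (auto simp: accessible_def)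
    then have "0 < \<pi> z * p t z x" using pos p_detailed_balance[of t x z] by (metis mult_pos_pos)
    then have "0 < p t z x" using pi_nonneg[of z] by (simp add: zero_less_mult_iff)
    then show "accessible M X z x" using t by (auto simp: accessible_def)
  qed
qed

text \<open>Finite mean return times need \<open>p 1 x x < 1\<close>, and \<open>z1\<close> secures
  this at \<open>z0\<close>, which would otherwise be allowed to be absorbing. From a null state the
  process moves in a finite \<open>F\<close> that it can leave only into the support.\<close>

lemma positive_recurrent_pi:
  assumes z0: "0 < \<pi> z0" and reach: "\<And>x t. 0 < t \<Longrightarrow> 0 < p t x z0"
    and z1: "0 < \<pi> z1" "z1 \<noteq> z0"
    and exits: "\<And>x. \<pi> x = 0 \<Longrightarrow> \<exists>F. finite F \<and> x \<in> F \<and>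
      (\<forall>v\<in>F. \<exists>D. finite D \<and> v \<in> D \<and> D \<subseteq> F \<union> {w. 0 < \<pi> w} \<and> (\<Sum>w\<in>D. R v w) = 0)"
  shows "positive_recurrent M X"
proof -
  have iff: "essential M X x \<longleftrightarrow> 0 < \<pi> x" for x using z0 reach by (rule essential_iff)
  show ?thesis
    unfolding positive_recurrent_def iff
  proof (intro conjI allI impI)
    fix x assume x: "0 < \<pi> x"
    \<comment> \<open>\<open>z1\<close> leads to \<open>z0\<close>, and detailed balance reverses
      this transition.\<close>
    have "0 < \<pi> z0 * p 1 z0 z1"
      using p_detailed_balance[of 1 z0 z1] reach[of 1 z1] z1 by simp
    then have "0 < p 1 z0 z1" using z0 by (simp add: zero_less_mult_iff)
    then have "\<exists>z. z \<noteq> x \<and> 0 < p 1 x z" using reach[of 1 x] z1(2) by (metis zero_less_one)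
    then obtain z where z: "z \<noteq> x" "0 < p 1 x z" by blast
    have "p 1 x x + p 1 x z \<le> 1" using p_sum_le_1[of 1 "{x, z}" x] z by simp
    then show "(\<integral>\<^sup>+ \<omega>. return_time X x \<omega> \<partial>M x) < \<infinity>"
      using z by (intro mean_return_time_finite x) simp
  next
    fix x
    show "AE \<omega> in M x. \<exists>t\<ge>0. 0 < \<pi> (X t \<omega>)"
    proof (cases "\<pi> x = 0")
      case True
      from exits[OF this] obtain F where F: "finite F" "x \<in> F" "\<forall>v\<in>F.
          \<exists>D. finite D \<and> v \<in> D \<and> D \<subseteq> F \<union> {w. 0 < \<pi> w} \<and> (\<Sum>w\<in>D. R v w) = 0"
        by (elim exE conjE) (rule that)
      have "AE \<omega> in M x. \<exists>t\<ge>0. X t \<omega> \<in> {w. 0 < \<pi> w}"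
      proof (rule AE_absorbed[OF F(1) _ bspec[OF F(3)] _ _ F(2)])
        show "p t u v = 0" if "u \<in> {w. 0 < \<pi> w}" "v \<notin> {w. 0 < \<pi> w}" "0 \<le> t" for u v t
          using that pi_nonneg[of v] by (intro p_eq_0_of_pi) auto
      qed (use z0 reach in auto)
      then show ?thesis by simp
    next
      case False
      then have "0 < \<pi> x" using pi_nonneg[of x] by simp
      show ?thesis using AE_X_0[of x]
        by eventually_elim (use \<open>0 < \<pi> x\<close> in \<open>auto intro!: exI[of _ 0]\<close>)
    qed
  qed
qed

end

section \<open>The network\<close>

lemma finite_functions_sum_le: "finite {n :: 's::finite \<Rightarrow> nat. (\<Sum>i\<in>UNIV. n i) \<le> N}"
proof (rule finite_subset)
  have "n i \<le> N" if "(\<Sum>i\<in>UNIV. n i) \<le> N" for n :: "'s \<Rightarrow> nat" and i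
    using that member_le_sum[of i UNIV n] by simp
  then show "{n :: 's \<Rightarrow> nat. (\<Sum>i\<in>UNIV. n i) \<le> N} \<subseteq> PiE UNIV (\<lambda>_. {..N})"
    by (auto simp: PiE_iff)
qed (auto intro!: finite_PiE)

text \<open>With finitely many sites the occupancies form
  \<open>PiE UNIV (\<lambda>_. UNIV)\<close>, and a finite product of absolutely convergent series
  can be expanded.\<close>

lemma has_sum_prod_functions:
  fixes f :: "'s::finite \<Rightarrow> nat \<Rightarrow> real"
  assumes nonneg: "\<And>q n. 0 \<le> f q n" and sum: "\<And>q. (f q has_sum s q) UNIV"
  shows "((\<lambda>n. \<Prod>q\<in>UNIV. f q (n q)) has_sum (\<Prod>q\<in>UNIV. s q)) UNIV"
proof -
  have summable: "f q summable_on UNIV" for q using sum[of q] by (auto simp: summable_on_def)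
  then have abs: "Infinite_Sum.abs_summable_on (f q) UNIV" for q by (simp add: nonneg)
  have "(\<Sum>\<^sub>\<infinity>n\<in>PiE UNIV (\<lambda>_. UNIV). \<Prod>q\<in>UNIV. f q (n q)) = (\<Prod>q\<in>UNIV. infsum (f q) UNIV)"
    by (intro infsum_prod_PiE_abs abs) auto
  moreover have "infsum (f q) UNIV = s q" for q by (rule infsumI[OF sum])
  moreover have "Infinite_Sum.abs_summable_on (\<lambda>n. \<Prod>q\<in>UNIV. f q (n q)) (PiE UNIV (\<lambda>_. UNIV))"
    unfolding abs_summable_equivalent
    by (intro abs_summable_on_prod_PiE) (auto simp flip: abs_summable_equivalent simp: nonneg summable)
  then have "(\<lambda>n. \<Prod>q\<in>UNIV. f q (n q)) summable_on UNIV"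
    by (simp add: nonneg prod_nonneg abs_prod)
  ultimately show ?thesis by (simp add: has_sum_iff)
qed

lemma sum_of_bool_UNIV:
  fixes f :: "'s::finite \<Rightarrow> real"
  shows "(\<Sum>k\<in>A. f k) = (\<Sum>k\<in>UNIV. f k * of_bool (k \<in> A))"
  by (rule sum.mono_neutral_cong_left) auto

text \<open>Occupancies that are at least 1 appear as \<open>Suc a\<close> in the balance relations,
  so that no truncated subtraction occurs. In \<open>gam_bar_pos\<close>, some configuration
  contains \<open>j\<close> but not \<open>j'\<close> exactly when the two sites differ.\<close>

locale network =
  fixes lam \<mu> :: "'s::finite \<Rightarrow> nat \<Rightarrow> 's set \<Rightarrow> real"
    and \<gamma> :: "'s \<Rightarrow> nat \<Rightarrow> real"
    and \<beta> \<theta> \<epsilon> :: "'s \<Rightarrow> 's \<Rightarrow> nat \<Rightarrow> nat \<Rightarrow> 's set \<Rightarrow> real"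
    and \<tau> :: "'s \<Rightarrow> 's \<Rightarrow> ('s \<Rightarrow> nat) \<Rightarrow> 's set \<Rightarrow> real"
    and \<xi> \<eta> :: "'s \<Rightarrow> real"
    and V :: "('s \<Rightarrow> nat) \<Rightarrow> real"
  assumes lam_nonneg: "0 \<le> lam i a y"
    and lam_support: "0 < lam i (Suc a) y \<Longrightarrow> 0 < lam i a y"
    and mu_pos: "1 \<le> a \<Longrightarrow> 0 < \<mu> i a y"
    and gam_nonneg: "0 \<le> \<gamma> i a"
    and gam_support: "0 < \<gamma> i (Suc a) \<Longrightarrow> 0 < \<gamma> i a"
    and gam_bar_pos: "j \<noteq> j' \<Longrightarrow> 0 < gam_bar \<gamma> j a"
    and xi_pos: "0 < \<xi> k"
    and eta_pos: "0 < \<eta> k"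
    and V_eq: "V n = (\<Prod>q\<in>UNIV. lam_bar lam q (n q) y / mu_bar \<mu> q (n q) y)"
    and beta_pos: "k \<noteq> l \<Longrightarrow> k \<notin> y \<Longrightarrow> l \<notin> y \<Longrightarrow> 0 < \<beta> k l a b y"
    and theta_pos: "j \<in> y \<Longrightarrow> k \<notin> y \<Longrightarrow> 0 < \<theta> j k a b y" "j \<in> y \<Longrightarrow> k \<notin> y \<Longrightarrow> 0 < \<theta> k j a b y"
    and eps_pos: "i \<noteq> j \<Longrightarrow> i \<in> y \<Longrightarrow> j \<in> y \<Longrightarrow> 0 < \<epsilon> i j a b y"
    and tau_pos: "j \<in> y \<Longrightarrow> j' \<notin> y \<Longrightarrow> 0 < \<tau> j j' n y"
    and beta_balance: "k \<noteq> l \<Longrightarrow> k \<notin> y \<Longrightarrow> l \<notin> y \<Longrightarrow>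
          lam k a y / \<mu> k (Suc a) y * \<beta> k l (Suc a) b y = lam l b y / \<mu> l (Suc b) y * \<beta> l k (Suc b) a y"
    and theta_balance: "j \<in> y \<Longrightarrow> k \<notin> y \<Longrightarrow>
          lam j a y / \<mu> j (Suc a) y * \<theta> j k (Suc a) b y = lam k b y / \<mu> k (Suc b) y * \<theta> k j (Suc b) a y"
    and eps_balance: "i \<noteq> j \<Longrightarrow> i \<in> y \<Longrightarrow> j \<in> y \<Longrightarrow>
          lam i a y * \<gamma> i a / \<mu> i (Suc a) y * \<epsilon> i j (Suc a) b y =
          lam j b y * \<gamma> j b / \<mu> j (Suc b) y * \<epsilon> j i (Suc b) a y"
    and tau_balance: "j \<in> y \<Longrightarrow> j' \<notin> y \<Longrightarrow>
          \<tau> j j' n y * (\<xi> j / \<eta> j) = \<tau> j' j n (move_customer j j' y) * (\<xi> j' / \<eta> j')"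
    and U_finite: "l \<notin> y \<Longrightarrow> summable (\<lambda>n. lam_bar lam l n y / mu_bar \<mu> l n y)"
    and L_finite: "r \<in> y \<Longrightarrow> summable (\<lambda>n. lam_bar lam r n y * gam_bar \<gamma> r n / mu_bar \<mu> r n y)"
begin

abbreviation rate :: "'s state \<Rightarrow> 's state \<Rightarrow> real" where
  "rate \<equiv> jump_rate lam \<mu> \<gamma> \<beta> \<theta> \<epsilon> \<tau> \<xi> \<eta>"

abbreviation gen :: "'s state \<Rightarrow> 's state \<Rightarrow> real" where
  "gen \<equiv> generator lam \<mu> \<gamma> \<beta> \<theta> \<epsilon> \<tau> \<xi> \<eta>"

abbreviation w :: "'s set \<Rightarrow> ('s \<Rightarrow> nat) \<Rightarrow> real" where
  "w \<equiv> weight V \<gamma> \<xi> \<eta>"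

abbreviation Z :: real where
  "Z \<equiv> partition_function V \<gamma> \<xi> \<eta>"

abbreviation \<pi> :: "'s state \<Rightarrow> real" where
  "\<pi> \<equiv> stationary_prob V \<gamma> \<xi> \<eta>"

abbreviation task_rate :: "'s \<Rightarrow> 's \<Rightarrow> ('s \<Rightarrow> nat) \<Rightarrow> 's set \<Rightarrow> real" where
  "task_rate \<equiv> task_move_rate \<gamma> \<beta> \<theta> \<epsilon>"

section \<open>Weights and the balance of single transitions\<close>

definition arrival :: "'s \<Rightarrow> nat \<Rightarrow> 's set \<Rightarrow> real" where
  "arrival i n y = lam i n y * (if i \<in> y then \<gamma> i n else 1)"

lemma arrival_nonneg: "0 \<le> arrival i n y"
  by (simp add: arrival_def lam_nonneg gam_nonneg)

lemma lam_bar_simps [simp]: "lam_bar lam i 0 y = 1" "lam_bar lam i (Suc n) y = lam_bar lam i n y * lam i n y"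
  by (simp_all add: lam_bar_def)

lemma mu_bar_simps [simp]: "mu_bar \<mu> i 0 y = 1" "mu_bar \<mu> i (Suc n) y = mu_bar \<mu> i n y * \<mu> i (Suc n) y"
  by (simp_all add: mu_bar_def mult.commute)

lemma gam_bar_simps [simp]: "gam_bar \<gamma> i 0 = 1" "gam_bar \<gamma> i (Suc n) = gam_bar \<gamma> i n * \<gamma> i n"
  by (simp_all add: gam_bar_def)

lemma lam_bar_nonneg: "0 \<le> lam_bar lam i n y"
  by (simp add: lam_bar_def lam_nonneg prod_nonneg)

lemma mu_bar_pos: "0 < mu_bar \<mu> i n y"
  unfolding mu_bar_def by (intro prod_pos) (auto intro: mu_pos)

lemma gam_bar_nonneg: "0 \<le> gam_bar \<gamma> i n"
  by (simp add: gam_bar_def gam_nonneg prod_nonneg)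

lemma weight_prod:
  "w y n = (\<Prod>q\<in>UNIV. lam_bar lam q (n q) y / mu_bar \<mu> q (n q) y
              * (if q \<in> y then \<xi> q * gam_bar \<gamma> q (n q) / \<eta> q else 1))"
proof -
  have "(\<Prod>j\<in>y. \<xi> j * gam_bar \<gamma> j (n j) / \<eta> j) =
      (\<Prod>q\<in>UNIV. if q \<in> y then \<xi> q * gam_bar \<gamma> q (n q) / \<eta> q else 1)"
    by (simp add: prod.If_cases)
  then show ?thesis by (simp only: weight_def V_eq[of n y] prod.distrib)
qed

lemma weight_nonneg: "0 \<le> w y n"
  unfolding weight_prod
  using lam_bar_nonneg mu_bar_pos gam_bar_nonneg xi_pos eta_pos
  by (intro prod_nonneg) (auto simp: less_imp_le intro!: mult_nonneg_nonneg divide_nonneg_nonneg)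

text \<open>In the product form only the factor of site \<open>p\<close> changes. The balances of
  all task transitions reduce to this ratio.\<close>

lemma weight_arrival:
  "w y (n(p := Suc (n p))) = w y n * (arrival p (n p) y / \<mu> p (Suc (n p)) y)"
proof -
  let ?f = "\<lambda>q a. lam_bar lam q a y / mu_bar \<mu> q a y * (if q \<in> y then \<xi> q * gam_bar \<gamma> q a / \<eta> q else 1)"
  have "w y (n(p := Suc (n p))) = ?f p (Suc (n p)) * (\<Prod>q\<in>UNIV - {p}. ?f q ((n(p := Suc (n p))) q))"
    unfolding weight_prod by (subst prod.remove[of UNIV p]) auto
  also have "(\<Prod>q\<in>UNIV - {p}. ?f q ((n(p := Suc (n p))) q)) = (\<Prod>q\<in>UNIV - {p}. ?f q (n q))"
    by (intro prod.cong) auto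
  also have "?f p (Suc (n p)) = ?f p (n p) * (arrival p (n p) y / \<mu> p (Suc (n p)) y)"
    by (simp add: arrival_def)
  also have "\<dots> * (\<Prod>q\<in>UNIV - {p}. ?f q (n q)) =
      (?f p (n p) * (\<Prod>q\<in>UNIV - {p}. ?f q (n q))) * (arrival p (n p) y / \<mu> p (Suc (n p)) y)"
    by (simp only: mult_ac)
  also have "?f p (n p) * (\<Prod>q\<in>UNIV - {p}. ?f q (n q)) = w y n"
    unfolding weight_prod by (rule prod.remove[symmetric]) auto
  finally show ?thesis .
qed

lemma arrival_balance: "w y n * arrival p (n p) y = w y (n(p := Suc (n p))) * \<mu> p (Suc (n p)) y"
  using mu_pos[of "Suc (n p)" p y] by (simp add: weight_arrival)

text \<open>In the mixed cases the balance of \<open>\<theta>\<close> is multiplied by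
  \<open>\<gamma>\<close> of the occupied site. On one side this factor belongs to the arrival
  intensity there, on the other to the rate of moving a task to that site.\<close>

lemma task_rate_balance:
  assumes "k \<noteq> l"
  shows "arrival k (n k) y / \<mu> k (Suc (n k)) y * task_rate k l (n(k := Suc (n k))) y =
    arrival l (n l) y / \<mu> l (Suc (n l)) y * task_rate l k (n(l := Suc (n l))) y"
proof -
  consider "k \<notin> y" "l \<notin> y" | "k \<in> y" "l \<in> y" | "k \<in> y" "l \<notin> y" | "k \<notin> y" "l \<in> y" by blast
  then show ?thesis
  proof cases
    case 1
    then show ?thesis
      using beta_balance[OF assms 1, of "n k" "n l"] assms by (simp add: arrival_def task_move_rate_def)
  next
    case 2
    then show ?thesis
      using eps_balance[OF assms 2, of "n k" "n l"] assms by (simp add: arrival_def task_move_rate_def)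
  next
    case 3
    then show ?thesis
      using arg_cong[OF theta_balance[OF 3, of "n k" "n l"], of "\<lambda>a. \<gamma> k (n k) * a"] assms
      by (simp add: arrival_def task_move_rate_def mult_ac)
  next
    case 4
    then show ?thesis
      using arg_cong[OF theta_balance[OF 4(2,1), of "n l" "n k"], of "\<lambda>a. \<gamma> l (n l) * a"] assms
      by (simp add: arrival_def task_move_rate_def mult_ac)
  qed
qed

text \<open>Both states arise by one arrival from \<open>n\<close> with a task removed at
  \<open>k\<close>, and their weights are compared through that common state.\<close>

lemma task_move_balance:
  assumes "k \<noteq> l" "1 \<le> n k"
  shows "w y n * task_rate k l n y = w y (move_task k l n) * task_rate l k (move_task k l n) y"
proof -
  define m where "m = n(k := n k - 1)"
  have n: "n = m(k := Suc (m k))" and move: "move_task k l n = m(l := Suc (m l))"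
    using assms by (auto simp: m_def move_task_def fun_eq_iff)
  show ?thesis
    unfolding move weight_arrival
    by (subst (1 2) n) (simp only: weight_arrival mult.assoc task_rate_balance[OF assms(1)])
qed

lemma weight_insert:
  assumes "k \<notin> y"
  shows "w (insert k y) n = w y n * (\<xi> k * gam_bar \<gamma> k (n k) / \<eta> k)"
  using assms by (simp add: weight_def)

lemma customer_balance:
  assumes "k \<notin> y"
  shows "w y n * (\<xi> k * gam_bar \<gamma> k (n k)) = w (insert k y) n * \<eta> k"
  using eta_pos[of k] by (simp add: weight_insert[OF assms])

text \<open>Both weights are multiples of \<open>w (y - {j}) n\<close>. The factors
  \<open>gam_bar\<close> cancel the reciprocals in the rates, which leaves
  \<open>tau_balance\<close>.\<close>

lemma customer_move_balance:
  assumes "j \<in> y" "j' \<notin> y"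
  shows "w y n * (\<tau> j j' n y / gam_bar \<gamma> j (n j)) =
    w (move_customer j j' y) n * (\<tau> j' j n (move_customer j j' y) / gam_bar \<gamma> j' (n j'))"
proof -
  have y: "y = insert j (y - {j})" and ne: "j \<noteq> j'" using assms by auto
  have pos: "0 < gam_bar \<gamma> j (n j)" "0 < gam_bar \<gamma> j' (n j')"
    using gam_bar_pos[OF ne] gam_bar_pos[OF ne[symmetric]] by auto
  have "w y n = w (y - {j}) n * (\<xi> j * gam_bar \<gamma> j (n j) / \<eta> j)"
    by (subst y, rule weight_insert) simp
  then have "w y n * (\<tau> j j' n y / gam_bar \<gamma> j (n j)) = w (y - {j}) n * (\<tau> j j' n y * (\<xi> j / \<eta> j))"
    using pos by (simp add: mult_ac)
  moreover have "w (move_customer j j' y) n = w (y - {j}) n * (\<xi> j' * gam_bar \<gamma> j' (n j') / \<eta> j')"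
    unfolding move_customer_def by (rule weight_insert) (use assms in auto)
  then have "w (move_customer j j' y) n * (\<tau> j' j n (move_customer j j' y) / gam_bar \<gamma> j' (n j')) =
      w (y - {j}) n * (\<tau> j' j n (move_customer j j' y) * (\<xi> j' / \<eta> j'))"
    using pos by (simp add: mult_ac)
  ultimately show ?thesis by (simp only: tau_balance[OF assms])
qed

section \<open>Rates sorted by type of transition, and detailed balance\<close>

definition arr_rate where
  "arr_rate x z = (case x of (y, n) \<Rightarrow> \<Sum>p\<in>UNIV. arrival p (n p) y * of_bool (z = (y, n(p := Suc (n p)))))"

definition dep_rate where
  "dep_rate x z = (case x of (y, n) \<Rightarrow> \<Sum>p\<in>UNIV. \<mu> p (n p) y * of_bool (1 \<le> n p \<and> z = (y, n(p := n p - 1))))"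

text \<open>Index conditions sit in \<open>of_bool\<close> so that the sums run over all sites. A
  transition and its reverse then carry the same indices up to order, and balance is checked summand
  by summand.\<close>

definition move_rate where
  "move_rate x z = (case x of (y, n) \<Rightarrow> \<Sum>k\<in>UNIV. \<Sum>l\<in>UNIV.
     task_rate k l n y * of_bool (1 \<le> n k \<and> k \<noteq> l \<and> z = (y, move_task k l n)))"

definition swap_rate where
  "swap_rate x z = (case x of (y, n) \<Rightarrow> \<Sum>j\<in>UNIV. \<Sum>j'\<in>UNIV.
     \<tau> j j' n y / gam_bar \<gamma> j (n j) * of_bool (j \<in> y \<and> j' \<notin> y \<and> z = (move_customer j j' y, n)))"

definition enter_rate where
  "enter_rate x z = (case x of (y, n) \<Rightarrow> \<Sum>k\<in>UNIV.
     \<xi> k * gam_bar \<gamma> k (n k) * of_bool (k \<notin> y \<and> z = (insert k y, n)))"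

definition leave_rate where
  "leave_rate x z = (case x of (y, n) \<Rightarrow> \<Sum>i\<in>UNIV. \<eta> i * of_bool (i \<in> y \<and> z = (y - {i}, n)))"

lemma rate_eq:
  "rate x z = arr_rate x z + dep_rate x z + move_rate x z + swap_rate x z + enter_rate x z + leave_rate x z"
proof (cases x)
  case (Pair y n)
  have "(\<Sum>k\<in>UNIV. \<Sum>l\<in>UNIV - {k}. task_rate k l n y * of_bool (1 \<le> n k \<and> z = (y, move_task k l n))) = move_rate x z"
    unfolding move_rate_def Pair prod.case
    by (subst sum_of_bool_UNIV, intro sum.cong refl) (auto intro!: sum.cong)
  moreover have "(\<Sum>j\<in>y. \<Sum>j'\<in>-y. \<tau> j j' n y / gam_bar \<gamma> j (n j) * of_bool (z = (move_customer j j' y, n))) = swap_rate x z"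
    unfolding swap_rate_def Pair prod.case
    by (subst (1 2) sum_of_bool_UNIV) (auto intro!: sum.cong simp: sum_distrib_right)
  moreover have "(\<Sum>k\<in>-y. \<xi> k * gam_bar \<gamma> k (n k) * of_bool (z = (insert k y, n))) = enter_rate x z"
    unfolding enter_rate_def Pair prod.case by (subst sum_of_bool_UNIV) (auto intro!: sum.cong)
  moreover have "(\<Sum>i\<in>y. \<eta> i * of_bool (z = (y - {i}, n))) = leave_rate x z"
    unfolding leave_rate_def Pair prod.case by (subst sum_of_bool_UNIV) (auto intro!: sum.cong)
  ultimately show ?thesis
    by (simp add: jump_rate_def Pair arr_rate_def dep_rate_def arrival_def mult.assoc)
qed

lemma arr_dep_balance: "w y n * arr_rate (y, n) (y', m) = w y' m * dep_rate (y', m) (y, n)"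
  unfolding arr_rate_def dep_rate_def prod.case sum_distrib_left
proof (intro sum.cong refl)
  fix p
  have iff: "(y', m) = (y, n(p := Suc (n p))) \<longleftrightarrow> 1 \<le> m p \<and> (y, n) = (y', m(p := m p - 1))"
    by (auto simp: fun_eq_iff)
  show "w y n * (arrival p (n p) y * of_bool ((y', m) = (y, n(p := Suc (n p))))) =
    w y' m * (\<mu> p (m p) y' * of_bool (1 \<le> m p \<and> (y, n) = (y', m(p := m p - 1))))"
    unfolding iff[symmetric] using arrival_balance[of y n p] by auto
qed

text \<open>The reverse of a move from \<open>k\<close> to \<open>l\<close> has the indices
  exchanged, hence \<open>sum.swap\<close>.\<close>

lemma move_balance: "w y n * move_rate (y, n) (y', m) = w y' m * move_rate (y', m) (y, n)"
  unfolding move_rate_def prod.case sum_distrib_left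
proof (subst (2) sum.swap, intro sum.cong refl)
  fix k l
  have iff: "1 \<le> n k \<and> k \<noteq> l \<and> (y', m) = (y, move_task k l n) \<longleftrightarrow>
      1 \<le> m l \<and> l \<noteq> k \<and> (y, n) = (y', move_task l k m)"
    by (auto simp: fun_eq_iff move_task_def)
  show "w y n * (task_rate k l n y * of_bool (1 \<le> n k \<and> k \<noteq> l \<and> (y', m) = (y, move_task k l n))) =
    w y' m * (task_rate l k m y' * of_bool (1 \<le> m l \<and> l \<noteq> k \<and> (y, n) = (y', move_task l k m)))"
    unfolding iff[symmetric] using task_move_balance[of k l n y] by auto
qed

lemma swap_balance: "w y n * swap_rate (y, n) (y', m) = w y' m * swap_rate (y', m) (y, n)"
  unfolding swap_rate_def prod.case sum_distrib_left
proof (subst (2) sum.swap, intro sum.cong refl)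
  fix j j'
  have iff: "j \<in> y \<and> j' \<notin> y \<and> (y', m) = (move_customer j j' y, n) \<longleftrightarrow>
      j' \<in> y' \<and> j \<notin> y' \<and> (y, n) = (move_customer j' j y', m)"
    by (auto simp: move_customer_def)
  show "w y n * (\<tau> j j' n y / gam_bar \<gamma> j (n j) * of_bool (j \<in> y \<and> j' \<notin> y \<and> (y', m) = (move_customer j j' y, n))) =
    w y' m * (\<tau> j' j m y' / gam_bar \<gamma> j' (m j') * of_bool (j' \<in> y' \<and> j \<notin> y' \<and> (y, n) = (move_customer j' j y', m)))"
    unfolding iff[symmetric] using customer_move_balance[of j y j' n] by auto
qed

lemma enter_leave_balance: "w y n * enter_rate (y, n) (y', m) = w y' m * leave_rate (y', m) (y, n)"
  unfolding enter_rate_def leave_rate_def prod.case sum_distrib_left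
proof (intro sum.cong refl)
  fix k
  have iff: "k \<notin> y \<and> (y', m) = (insert k y, n) \<longleftrightarrow> k \<in> y' \<and> (y, n) = (y' - {k}, m)" by auto
  show "w y n * (\<xi> k * gam_bar \<gamma> k (n k) * of_bool (k \<notin> y \<and> (y', m) = (insert k y, n))) =
    w y' m * (\<eta> k * of_bool (k \<in> y' \<and> (y, n) = (y' - {k}, m)))"
    unfolding iff[symmetric] using customer_balance[of k y n] by auto
qed

lemma pi_eq: "\<pi> (y, n) = w y n / Z"
  by (simp add: stationary_prob_def weight_def)

lemma generator_detailed_balance: "\<pi> x * gen x z = \<pi> z * gen z x"
proof (cases "x = z")
  case False
  obtain y n y' m where x: "x = (y, n)" and z: "z = (y', m)" by (cases x, cases z) blast
  have "w y n * rate (y, n) (y', m) = w y' m * rate (y', m) (y, n)"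
    unfolding rate_eq distrib_left
    using arr_dep_balance[of y n y' m] arr_dep_balance[of y' m y n] move_balance[of y n y' m]
      swap_balance[of y n y' m] enter_leave_balance[of y n y' m] enter_leave_balance[of y' m y n] by simp
  then show ?thesis using False by (simp add: generator_def x z pi_eq)
qed simp

section \<open>Normalisation\<close>

lemma weight_has_sum:
  "(w y has_sum ((\<Prod>r\<in>y. \<xi> r * L_sum lam \<mu> \<gamma> r y / \<eta> r) * (\<Prod>l\<in>-y. U_sum lam \<mu> l y))) UNIV"
proof -
  let ?f = "\<lambda>q a. lam_bar lam q a y / mu_bar \<mu> q a y * (if q \<in> y then \<xi> q * gam_bar \<gamma> q a / \<eta> q else 1)"
  let ?s = "\<lambda>q. if q \<in> y then \<xi> q * L_sum lam \<mu> \<gamma> q y / \<eta> q else U_sum lam \<mu> q y"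
  have nonneg: "0 \<le> ?f q a" for q a
    using lam_bar_nonneg[of q a y] mu_bar_pos[of q a y] gam_bar_nonneg[of q a] xi_pos[of q] eta_pos[of q]
    by (auto simp: less_imp_le intro!: mult_nonneg_nonneg divide_nonneg_nonneg)
  have "(?f q has_sum ?s q) UNIV" for q
  proof (rule sums_nonneg_imp_has_sum)
    show "?f q sums ?s q"
    proof (cases "q \<in> y")
      case True
      have "(\<lambda>a. \<xi> q / \<eta> q * (lam_bar lam q a y * gam_bar \<gamma> q a / mu_bar \<mu> q a y)) sums
          (\<xi> q / \<eta> q * L_sum lam \<mu> \<gamma> q y)"
        unfolding L_sum_def by (intro sums_mult summable_sums L_finite True)
      then show ?thesis using True by (simp add: mult_ac)
    next
      case False
      then show ?thesis using summable_sums[OF U_finite[OF False]] by (simp add: U_sum_def)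
    qed
  qed (rule nonneg)
  then have "(w y has_sum (\<Prod>q\<in>UNIV. ?s q)) UNIV"
    unfolding weight_prod[abs_def] by (intro has_sum_prod_functions nonneg)
  moreover have "(\<Prod>q\<in>UNIV. ?s q) =
      (\<Prod>r\<in>y. \<xi> r * L_sum lam \<mu> \<gamma> r y / \<eta> r) * (\<Prod>l\<in>-y. U_sum lam \<mu> l y)"
    by (simp add: prod.If_cases Compl_eq)
  ultimately show ?thesis by simp
qed

lemma weight_summable: "w y summable_on UNIV"
  using weight_has_sum by (auto simp: summable_on_def)

lemma partition_function_eq:
  "Z = (\<Sum>y\<in>UNIV. (\<Prod>r\<in>y. \<xi> r * L_sum lam \<mu> \<gamma> r y / \<eta> r) * (\<Prod>l\<in>-y. U_sum lam \<mu> l y))"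
  unfolding partition_function_def using infsumI[OF weight_has_sum] by simp

lemma weight_empty_0: "w {} (\<lambda>_. 0) = 1"
  by (simp add: weight_prod)

lemma weight_le_Z: "w y n \<le> Z"
proof -
  have "w y n \<le> (\<Sum>\<^sub>\<infinity>n. w y n)"
  proof (rule has_sum_mono2)
    show "(w y has_sum w y n) {n}" by (simp add: has_sum_finite_iff)
    show "(w y has_sum (\<Sum>\<^sub>\<infinity>n. w y n)) UNIV" by (rule has_sum_infsum[OF weight_summable])
  qed (auto simp: weight_nonneg)
  also have "\<dots> \<le> (\<Sum>y\<in>UNIV. \<Sum>\<^sub>\<infinity>n. w y n)"
    by (rule member_le_sum) (auto intro!: infsum_nonneg weight_nonneg)
  finally show ?thesis by (simp add: partition_function_def)
qed

lemma Z_pos: "0 < Z"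
  using weight_le_Z[of "{}" "\<lambda>_. 0"] by (simp add: weight_empty_0)

lemma pi_pos_iff: "0 < \<pi> (y, n) \<longleftrightarrow> 0 < w y n"
  using Z_pos by (simp add: pi_eq zero_less_divide_iff)

lemma pi_nonneg: "0 \<le> \<pi> x"
  using Z_pos by (cases x) (simp add: pi_eq weight_nonneg)

lemma pi_has_sum: "(\<pi> has_sum 1) UNIV"
proof -
  have inner: "((\<lambda>n. \<pi> (y, n)) has_sum ((\<Sum>\<^sub>\<infinity>n. w y n) / Z)) UNIV" for y
    using has_sum_cmult_left[OF has_sum_infsum[OF weight_summable], of y "1 / Z"] by (simp add: pi_eq)
  have outer: "((\<lambda>y. (\<Sum>\<^sub>\<infinity>n. w y n) / Z) has_sum 1) UNIV"
    using Z_pos by (simp add: has_sum_finite_iff sum_divide_distrib[symmetric] flip: partition_function_def)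
  have "\<pi> summable_on (UNIV \<times> UNIV)"
    using inner outer pi_nonneg by (intro summable_on_SigmaI) (auto simp: summable_on_def)
  then have "(\<pi> has_sum 1) (UNIV \<times> UNIV)" using inner outer by (intro has_sum_SigmaI)
  then show ?thesis by simp
qed

section \<open>Signs of the rates and the number of tasks\<close>

lemma task_rate_nonneg: "k \<noteq> l \<Longrightarrow> 0 \<le> task_rate k l n y"
  using beta_pos[of k l y] eps_pos[of k l y] theta_pos gam_nonneg
  by (auto simp: task_move_rate_def less_imp_le)

lemma rate_parts_nonneg:
  "0 \<le> arr_rate x z" "0 \<le> dep_rate x z" "0 \<le> move_rate x z" "0 \<le> swap_rate x z"
  "0 \<le> enter_rate x z" "0 \<le> leave_rate x z"
proof -
  have dep: "0 \<le> \<mu> p a y * of_bool (1 \<le> a \<and> P)" for p a y P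
    using mu_pos[of a p y] by (auto simp: less_imp_le)
  show "0 \<le> dep_rate x z"
    unfolding dep_rate_def by (cases x) (simp only: prod.case, intro sum_nonneg dep)
  have mov: "0 \<le> task_rate k l n y * of_bool (1 \<le> n k \<and> k \<noteq> l \<and> P)" for k l n y P
    using task_rate_nonneg[of k l n y] by auto
  show "0 \<le> move_rate x z"
    unfolding move_rate_def by (cases x) (simp only: prod.case, intro sum_nonneg mov)
  have swp: "0 \<le> \<tau> j j' n y / gam_bar \<gamma> j (n j) * of_bool (j \<in> y \<and> j' \<notin> y \<and> P)" for j j' n y P
    using tau_pos[of j y j' n] gam_bar_nonneg[of j "n j"] by (auto simp: less_imp_le)
  show "0 \<le> swap_rate x z"
    unfolding swap_rate_def by (cases x) (simp only: prod.case, intro sum_nonneg swp)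
  show "0 \<le> arr_rate x z" "0 \<le> enter_rate x z" "0 \<le> leave_rate x z"
    using arrival_nonneg xi_pos eta_pos gam_bar_nonneg
    by (auto simp: arr_rate_def enter_rate_def leave_rate_def less_imp_le split: prod.split intro!: sum_nonneg)
qed

lemma rate_departure_pos:
  assumes "1 \<le> n p"
  shows "0 < rate (y, n) (y, n(p := n p - 1))"
proof -
  have "0 < \<mu> p (n p) y" using assms by (rule mu_pos)
  also have "\<dots> = \<mu> p (n p) y * of_bool (1 \<le> n p \<and> (y, n(p := n p - 1)) = (y, n(p := n p - 1)))"
    using assms by simp
  also have "\<dots> \<le> dep_rate (y, n) (y, n(p := n p - 1))"
    unfolding dep_rate_def prod.case
  proof (rule member_le_sum)
    fix q show "0 \<le> \<mu> q (n q) y * of_bool (1 \<le> n q \<and> (y, n(p := n p - 1)) = (y, n(q := n q - 1)))"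
      using mu_pos[of "n q" q y] by (auto simp: less_imp_le)
  qed auto
  also have "\<dots> \<le> rate (y, n) (y, n(p := n p - 1))"
    unfolding rate_eq
    using rate_parts_nonneg[of "(y, n)" "(y, n(p := n p - 1))"] by linarith
  finally show ?thesis .
qed

lemma rate_leave_pos:
  assumes "i \<in> y"
  shows "0 < rate (y, n) (y - {i}, n)"
proof -
  have "0 < \<eta> i * of_bool (i \<in> y \<and> (y - {i}, n) = (y - {i}, n))" using assms eta_pos by simp
  also have "\<dots> \<le> leave_rate (y, n) (y - {i}, n)"
    unfolding leave_rate_def prod.case by (rule member_le_sum) (auto simp: eta_pos less_imp_le)
  also have "\<dots> \<le> rate (y, n) (y - {i}, n)"
    unfolding rate_eq using rate_parts_nonneg[of "(y, n)" "(y - {i}, n)"] by linarith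
  finally show ?thesis .
qed

text \<open>Its sublevel sets are finite and only arrivals raise it; this confines the process
  started in a null state.\<close>

definition tasks :: "'s state \<Rightarrow> nat" where
  "tasks x = (\<Sum>i\<in>UNIV. snd x i)"

lemma tasks_update: "tasks (y, n(p := a)) + n p = tasks (y, n) + a"
proof -
  have "tasks (y, n(p := a)) = a + (\<Sum>i\<in>UNIV - {p}. n i)"
    unfolding tasks_def snd_conv by (subst sum.remove[of UNIV p]) (auto intro!: sum.cong)
  moreover have "tasks (y, n) = n p + (\<Sum>i\<in>UNIV - {p}. n i)"
    unfolding tasks_def snd_conv by (subst sum.remove[of UNIV p]) auto
  ultimately show ?thesis by simp
qed

lemma tasks_move:
  assumes "1 \<le> n k" "k \<noteq> l"
  shows "tasks (y, move_task k l n) = tasks (y, n)"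
  using tasks_update[of y "n(k := n k - 1)" l "n l + 1"] tasks_update[of y n k "n k - 1"] assms
  by (simp add: move_task_def)

lemma finite_tasks_le: "finite {x :: 's state. tasks x \<le> N}"
proof (rule finite_subset)
  show "{x :: 's state. tasks x \<le> N} \<subseteq> UNIV \<times> {n. (\<Sum>i\<in>UNIV. n i) \<le> N}" by (auto simp: tasks_def)
qed (simp add: finite_functions_sum_le)

lemma rate_nonzero_cases:
  assumes "rate (y, n) z \<noteq> 0"
  obtains (arrival) p where "arrival p (n p) y \<noteq> 0" "z = (y, n(p := Suc (n p)))"
    | (other) "tasks z \<le> tasks (y, n)"
proof (cases "arr_rate (y, n) z = 0")
  case False
  then obtain p where "arrival p (n p) y * of_bool (z = (y, n(p := Suc (n p)))) \<noteq> 0"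
    unfolding arr_rate_def prod.case by (rule sum.not_neutral_contains_not_neutral)
  then show thesis using arrival by auto
next
  case True
  have "tasks z \<le> tasks (y, n)"
  proof (rule ccontr)
    assume gt: "\<not> ?thesis"
    have "z \<noteq> (y, n(p := n p - 1))" for p using gt tasks_update[of y n p "n p - 1"] by auto
    then have "dep_rate (y, n) z = 0" by (auto simp: dep_rate_def)
    moreover have "\<not> (1 \<le> n k \<and> k \<noteq> l \<and> z = (y, move_task k l n))" for k l
      using gt tasks_move[of n k l y] by auto
    then have "move_rate (y, n) z = 0" by (simp only: move_rate_def prod.case) simp
    moreover have "z \<noteq> (y', n)" for y' using gt by (auto simp: tasks_def)
    then have "swap_rate (y, n) z = 0" "enter_rate (y, n) z = 0" "leave_rate (y, n) z = 0"
      by (auto simp: swap_rate_def enter_rate_def leave_rate_def)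
    ultimately show False using True assms by (simp add: rate_eq)
  qed
  then show thesis by (rule other)
qed

text \<open>The diagonal entry is an infinite sum, which reduces to a finite one because all targets
  lie in \<open>D\<close>. This supplies the zero row sums of the absorption argument.\<close>

lemma gen_row_sum:
  assumes "finite D" "x \<in> D" "\<And>z. rate x z \<noteq> 0 \<Longrightarrow> z \<in> D"
  shows "(\<Sum>z\<in>D. gen x z) = 0"
proof -
  have "(rate x has_sum (\<Sum>z\<in>D - {x}. rate x z)) (- {x})"
    using assms by (intro has_sum_finite_neutralI) auto
  then have "gen x x = - (\<Sum>z\<in>D - {x}. rate x z)" by (simp add: generator_def infsumI)
  moreover have "(\<Sum>z\<in>D. gen x z) = gen x x + (\<Sum>z\<in>D - {x}. gen x z)"
    using assms by (rule_tac sum.remove) auto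
  moreover have "(\<Sum>z\<in>D - {x}. gen x z) = (\<Sum>z\<in>D - {x}. rate x z)"
    by (intro sum.cong) (auto simp: generator_def)
  ultimately show ?thesis by simp
qed

section \<open>States of weight zero\<close>

lemma lam_pos_mono: "0 < lam i n y \<Longrightarrow> m \<le> n \<Longrightarrow> 0 < lam i m y"
  by (induction n) (auto simp: le_Suc_eq dest: lam_support)

lemma gam_pos_mono: "0 < \<gamma> i n \<Longrightarrow> m \<le> n \<Longrightarrow> 0 < \<gamma> i m"
  by (induction n) (auto simp: le_Suc_eq dest: gam_support)

text \<open>The number of tasks does not grow outside the support of \<open>\<pi>\<close>.\<close>

lemma arrival_eq_0:
  assumes "w y n = 0"
  shows "arrival p (n p) y = 0"
proof (rule ccontr)
  assume "arrival p (n p) y \<noteq> 0"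
  then have "0 < arrival p (n p) y" using arrival_nonneg[of p "n p" y] by simp
  then have lam_p: "0 < lam p (n p) y" and gam_p: "p \<in> y \<Longrightarrow> 0 < \<gamma> p (n p)"
    using lam_nonneg[of p "n p" y] gam_nonneg[of p "n p"]
    by (auto simp: arrival_def zero_less_mult_iff split: if_splits)
  \<comment> \<open>In the balance between \<open>p\<close> and \<open>q\<close> the occupancy of
    \<open>q\<close> is free, so a positive side at \<open>n p\<close> forces
    \<open>lam q m y\<close> to be positive for every \<open>m\<close>.\<close>
  have lam_q: "0 < lam q m y" if "q \<noteq> p" for q m
  proof -
    have *: "0 < lam p (n p) y / \<mu> p (Suc (n p)) y" using lam_p mu_pos[of "Suc (n p)" p y] by simp
    have nz: "0 < lam q m y" if "0 < A" "A = B" "lam q m y = 0 \<Longrightarrow> B = 0" for A B :: real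
      using that lam_nonneg[of q m y] by (cases "lam q m y = 0") auto
    consider "p \<notin> y" "q \<notin> y" | "p \<in> y" "q \<in> y" | "p \<in> y" "q \<notin> y" | "p \<notin> y" "q \<in> y" by blast
    then show ?thesis
    proof cases
      case 1
      have "0 < lam p (n p) y / \<mu> p (Suc (n p)) y * \<beta> p q (Suc (n p)) m y"
        using 1 that by (intro mult_pos_pos * beta_pos) auto
      then show ?thesis
        by (rule nz[OF _ beta_balance[of p q y "n p" m]]) (use 1 that in auto)
    next
      case 2
      have "0 < lam p (n p) y / \<mu> p (Suc (n p)) y * \<gamma> p (n p) * \<epsilon> p q (Suc (n p)) m y"
        using 2 that by (intro mult_pos_pos * gam_p eps_pos) auto
      then show ?thesis
        by (intro nz[OF _ eps_balance[of p q y "n p" m]]) (use 2 that in auto)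
    next
      case 3
      have "0 < lam p (n p) y / \<mu> p (Suc (n p)) y * \<theta> p q (Suc (n p)) m y"
        using 3 by (intro mult_pos_pos * theta_pos) auto
      then show ?thesis
        by (rule nz[OF _ theta_balance[of p y q "n p" m]]) (use 3 in auto)
    next
      case 4
      have "0 < lam p (n p) y / \<mu> p (Suc (n p)) y * \<theta> p q (Suc (n p)) m y"
        using 4 by (intro mult_pos_pos * theta_pos) auto
      then show ?thesis
        by (rule nz[OF _ theta_balance[of q y p m "n p", symmetric]]) (use 4 in auto)
    qed
  qed
  have "0 < lam q m y" if "m < n q" for q m
    using lam_q[of q m] lam_pos_mono[OF lam_p, of m] that by (cases "q = p") auto
  then have "0 < lam_bar lam q (n q) y" for q unfolding lam_bar_def by (intro prod_pos) auto
  \<comment> \<open>For \<open>q\<close> different from \<open>p\<close> a second site exists and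
    \<open>gam_bar_pos\<close> applies; at \<open>p\<close> itself positivity descends from
    \<open>\<gamma> p (n p)\<close>.\<close>
  moreover have "0 < gam_bar \<gamma> q (n q)" if "q \<in> y" for q
  proof (cases "q = p")
    case True
    then show ?thesis unfolding gam_bar_def using gam_pos_mono[OF gam_p] that
      by (intro prod_pos) auto
  qed (rule gam_bar_pos)
  ultimately have "0 < w y n"
    unfolding weight_prod using mu_bar_pos xi_pos eta_pos by (intro prod_pos) auto
  then show False using assms by simp
qed

text \<open>No arrival leaves a null state, so its jumps lead to states with at most
  \<open>tasks x\<close> tasks. That finite set serves as \<open>D\<close>; its null states form
  \<open>F\<close> and the others lie in the support.\<close>

lemma exits_from_null_states:
  assumes "\<pi> x = 0"
  shows "\<exists>F. finite F \<and> x \<in> F \<and> (\<forall>v\<in>F. \<exists>D. finite D \<and> v \<in> D \<and> D \<subseteq> F \<union> {u. 0 < \<pi> u} \<and> (\<Sum>u\<in>D. gen v u) = 0)"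
proof (rule exI[of _ "{v. tasks v \<le> tasks x \<and> \<pi> v = 0}"], intro conjI ballI)
  show "finite {v. tasks v \<le> tasks x \<and> \<pi> v = 0}"
    using finite_tasks_le by (rule rev_finite_subset) auto
  fix v assume v: "v \<in> {v. tasks v \<le> tasks x \<and> \<pi> v = 0}"
  have "(\<Sum>u\<in>{u. tasks u \<le> tasks x}. gen v u) = 0"
  proof (rule gen_row_sum)
    fix u assume u: "rate v u \<noteq> 0"
    obtain y n where yn: "v = (y, n)" by (cases v)
    have null: "w y n = 0" using v Z_pos by (auto simp: yn pi_eq)
    have "tasks u \<le> tasks v"
      using u[unfolded yn] by (cases rule: rate_nonzero_cases) (auto simp: yn arrival_eq_0[OF null])
    then show "u \<in> {u. tasks u \<le> tasks x}" using v by simp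
  qed (use v finite_tasks_le in auto)
  then show "\<exists>D. finite D \<and> v \<in> D \<and> D \<subseteq> {v. tasks v \<le> tasks x \<and> \<pi> v = 0} \<union> {u. 0 < \<pi> u} \<and> (\<Sum>u\<in>D. gen v u) = 0"
    using v finite_tasks_le[of "tasks x"] pi_nonneg
    by (intro exI[of _ "{u. tasks u \<le> tasks x}"]) (auto simp: order_le_less)
qed (use assms in auto)

lemma process_with_generator:
  fixes M :: "'s state \<Rightarrow> 'w measure"
  assumes "markov_process_with_generator M X gen"
  shows "positive_recurrent M X \<and> reversible_process M X \<pi> \<and>
    (\<forall>p. stationary_distribution M X p \<longleftrightarrow> p = \<pi>)"
proof -
  have "countable (UNIV :: 's state set)"
    unfolding UNIV_Times_UNIV[symmetric] by (intro countable_SIGMA) (auto intro: countable_finite)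
  then interpret proc: reversible_jump_process M X gen \<pi>
    using assms pi_nonneg pi_has_sum generator_detailed_balance by unfold_locales auto
  let ?z0 = "({}, \<lambda>_. 0) :: 's state"
  \<comment> \<open>Drain the network: customers leave at rates \<open>\<eta>\<close>, then tasks
    depart at rates \<open>\<mu>\<close>; the induction is on their total number.\<close>
  have reach: "0 < trans_prob M X t x ?z0" if "0 < t" for t x
    using that
  proof (induction "tasks x + card (fst x)" arbitrary: x t rule: less_induct)
    case less
    obtain y n where x: "x = (y, n)" by (cases x)
    show ?case
    proof (cases "y = {}")
      case False
      then obtain i where i: "i \<in> y" by blast
      have ne: "(y, n) \<noteq> (y - {i}, n)" using i by auto
      have "card (y - {i}) < card y" using i by (intro psubset_card_mono) auto
      then have G: "0 < trans_prob M X s (y - {i}, n) ?z0" if "0 < s" for s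
        using less.hyps[of "(y - {i}, n)"] that by (simp add: x tasks_def)
      have "0 < gen (y, n) (y - {i}, n)"
        using ne rate_leave_pos[OF i, of n] by (simp only: generator_def if_False)
      then show ?thesis unfolding x by (rule proc.p_pos_step[OF ne _ G less.prems])
    next
      case True
      show ?thesis
      proof (cases "\<exists>p. n p \<noteq> 0")
        case True
        then obtain p where "n p \<noteq> 0" by blast
        then have p: "1 \<le> n p" by simp
        have ne: "(y, n) \<noteq> (y, n(p := n p - 1))" using p by (auto simp: fun_eq_iff)
        have "tasks (y, n(p := n p - 1)) < tasks (y, n)" using tasks_update[of y n p "n p - 1"] p by simp
        then have G: "0 < trans_prob M X s (y, n(p := n p - 1)) ?z0" if "0 < s" for s
          using less.hyps[of "(y, n(p := n p - 1))"] that by (simp add: x)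
        have "0 < gen (y, n) (y, n(p := n p - 1))"
          using ne rate_departure_pos[of n p y, OF p] by (simp only: generator_def if_False)
        then show ?thesis unfolding x by (rule proc.p_pos_step[OF ne _ G less.prems])
      next
        case False
        then have "x = ?z0" using \<open>y = {}\<close> by (auto simp: x fun_eq_iff)
        then show ?thesis using less.prems proc.p_same_pos[of t ?z0] by simp
      qed
    qed
  qed
  have z0: "0 < \<pi> ?z0" by (simp add: pi_pos_iff weight_empty_0)
  \<comment> \<open>A second state of positive weight: one customer at an arbitrary site and no
    tasks.\<close>
  have z1: "0 < \<pi> ({undefined}, \<lambda>_. 0)"
    using xi_pos eta_pos by (simp add: pi_pos_iff weight_insert weight_empty_0)
  have "positive_recurrent M X"
    using z0 reach z1 by (rule proc.positive_recurrent_pi) (auto intro: exits_from_null_states)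
  moreover have "stationary_distribution M X p \<longleftrightarrow> p = \<pi>" for p
    using proc.stationary_distribution_unique[of ?z0 p] proc.stationary_distribution_pi reach by auto
  ultimately show ?thesis using proc.reversible_process_pi by blast
qed

end

theorem theorem4p2:
  fixes lam \<mu> :: "'s::finite \<Rightarrow> nat \<Rightarrow> 's set \<Rightarrow> real"
    and \<gamma> :: "'s \<Rightarrow> nat \<Rightarrow> real"
    and \<beta> \<theta> \<epsilon> :: "'s \<Rightarrow> 's \<Rightarrow> nat \<Rightarrow> nat \<Rightarrow> 's set \<Rightarrow> real"
    and \<tau> :: "'s \<Rightarrow> 's \<Rightarrow> ('s \<Rightarrow> nat) \<Rightarrow> 's set \<Rightarrow> real"
    and \<xi> \<eta> :: "'s \<Rightarrow> real"
    and V :: "('s \<Rightarrow> nat) \<Rightarrow> real"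
  assumes lam_nonneg: "\<forall>i n y. 0 \<le> lam i n y"
    and lam_bounded: "\<exists>C. \<forall>i n y. lam i n y \<le> C"
    and lam_support: "\<forall>i n y. 0 < lam i (n + 1) y \<longrightarrow> 0 < lam i n y"
    and mu_bounded_below: "\<exists>c>0. \<forall>i n y. 1 \<le> n \<longrightarrow> c \<le> \<mu> i n y"
    and gam_nonneg: "\<forall>i n. 0 \<le> \<gamma> i n"
    and gam_0: "\<forall>i. \<gamma> i 0 = 1"
    and gam_support: "\<forall>i n. 0 < \<gamma> i (n + 1) \<longrightarrow> 0 < \<gamma> i n"
    and gam_bar_pos: "\<forall>(y :: 's set) j j' n. j \<in> y \<longrightarrow> j' \<notin> y \<longrightarrow> 0 < gam_bar \<gamma> j n"
    and xi_pos: "\<forall>k. 0 < \<xi> k"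
    and eta_pos: "\<forall>k. 0 < \<eta> k"
    and V: "\<forall>n y. V n = (\<Prod>q\<in>UNIV. lam_bar lam q (n q) y / mu_bar \<mu> q (n q) y)"
    and beta_pos: "\<forall>y k l m n. k \<noteq> l \<longrightarrow> k \<notin> y \<longrightarrow> l \<notin> y \<longrightarrow> 0 < \<beta> k l m n y"
    and theta_pos: "\<forall>y j k m n. j \<in> y \<longrightarrow> k \<notin> y \<longrightarrow> 0 < \<theta> j k m n y \<and> 0 < \<theta> k j m n y"
    and eps_pos: "\<forall>y i j m n. i \<noteq> j \<longrightarrow> i \<in> y \<longrightarrow> j \<in> y \<longrightarrow> 0 < \<epsilon> i j m n y"
    and tau_pos: "\<forall>y j j' n. j \<in> y \<longrightarrow> j' \<notin> y \<longrightarrow> 0 < \<tau> j j' n y"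
    and beta_balance: "\<forall>y k l m n. k \<noteq> l \<longrightarrow> k \<notin> y \<longrightarrow> l \<notin> y \<longrightarrow> 1 \<le> m \<longrightarrow>
          lam k (m - 1) y / \<mu> k m y * \<beta> k l m n y =
          lam l n y / \<mu> l (n + 1) y * \<beta> l k (n + 1) (m - 1) y"
    and theta_balance: "\<forall>y j k m n. j \<in> y \<longrightarrow> k \<notin> y \<longrightarrow> 1 \<le> m \<longrightarrow>
          lam j (m - 1) y / \<mu> j m y * \<theta> j k m n y =
          lam k n y / \<mu> k (n + 1) y * \<theta> k j (n + 1) (m - 1) y"
    and eps_balance: "\<forall>y i j m n. i \<noteq> j \<longrightarrow> i \<in> y \<longrightarrow> j \<in> y \<longrightarrow> 1 \<le> m \<longrightarrow>
          lam i (m - 1) y * \<gamma> i (m - 1) / \<mu> i m y * \<epsilon> i j m n y =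
          lam j n y * \<gamma> j n / \<mu> j (n + 1) y * \<epsilon> j i (n + 1) (m - 1) y"
    and tau_balance: "\<forall>y j j' n. j \<in> y \<longrightarrow> j' \<notin> y \<longrightarrow>
          \<tau> j j' n y * (\<xi> j / \<eta> j) = \<tau> j' j n (move_customer j j' y) * (\<xi> j' / \<eta> j')"
    and U_finite: "\<forall>y l. l \<notin> y \<longrightarrow> summable (\<lambda>n. lam_bar lam l n y / mu_bar \<mu> l n y)"
    and L_finite: "\<forall>y r. r \<in> y \<longrightarrow>
          summable (\<lambda>n. lam_bar lam r n y * gam_bar \<gamma> r n / mu_bar \<mu> r n y)"
  shows "(\<forall>y. weight V \<gamma> \<xi> \<eta> y summable_on UNIV) \<and>
         partition_function V \<gamma> \<xi> \<eta> =
           (\<Sum>y\<in>UNIV. (\<Prod>r\<in>y. \<xi> r * L_sum lam \<mu> \<gamma> r y / \<eta> r) * (\<Prod>l\<in>-y. U_sum lam \<mu> l y)) \<and>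
         (\<forall>x z. stationary_prob V \<gamma> \<xi> \<eta> x * generator lam \<mu> \<gamma> \<beta> \<theta> \<epsilon> \<tau> \<xi> \<eta> x z =
                stationary_prob V \<gamma> \<xi> \<eta> z * generator lam \<mu> \<gamma> \<beta> \<theta> \<epsilon> \<tau> \<xi> \<eta> z x) \<and>
         (\<forall>(M :: 's state \<Rightarrow> 'w measure) X.
            markov_process_with_generator M X (generator lam \<mu> \<gamma> \<beta> \<theta> \<epsilon> \<tau> \<xi> \<eta>) \<longrightarrow>
            positive_recurrent M X \<and>
            reversible_process M X (stationary_prob V \<gamma> \<xi> \<eta>) \<and>
            (\<forall>p. stationary_distribution M X p \<longleftrightarrow> p = stationary_prob V \<gamma> \<xi> \<eta>))"
proof -
  obtain C where C: "0 < C" "\<And>i n y. 1 \<le> n \<Longrightarrow> C \<le> \<mu> i n y" using mu_bounded_below by blast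
  have mu_pos: "0 < \<mu> i n y" if "1 \<le> n" for i n y using C(2)[OF that, of i y] C(1) by simp
  \<comment> \<open>The configuration \<open>{j}\<close> contains \<open>j\<close> and not
    \<open>j'\<close>.\<close>
  have gam_bar_pos': "0 < gam_bar \<gamma> j n" if "j \<noteq> j'" for j j' n
    using gam_bar_pos[rule_format, of j "{j}" j' n] that by simp
  interpret network lam \<mu> \<gamma> \<beta> \<theta> \<epsilon> \<tau> \<xi> \<eta> V
  proof
    fix k l :: 's and y and a b :: nat
    assume "k \<noteq> l" "k \<notin> y" "l \<notin> y"
    then show "lam k a y / \<mu> k (Suc a) y * \<beta> k l (Suc a) b y = lam l b y / \<mu> l (Suc b) y * \<beta> l k (Suc b) a y"
      using beta_balance[rule_format, of k l y "Suc a" b] by simp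
  next
    fix j k :: 's and y and a b :: nat
    assume "j \<in> y" "k \<notin> y"
    then show "lam j a y / \<mu> j (Suc a) y * \<theta> j k (Suc a) b y = lam k b y / \<mu> k (Suc b) y * \<theta> k j (Suc b) a y"
      using theta_balance[rule_format, of j y k "Suc a" b] by simp
  next
    fix i j :: 's and y and a b :: nat
    assume "i \<noteq> j" "i \<in> y" "j \<in> y"
    then show "lam i a y * \<gamma> i a / \<mu> i (Suc a) y * \<epsilon> i j (Suc a) b y =
        lam j b y * \<gamma> j b / \<mu> j (Suc b) y * \<epsilon> j i (Suc b) a y"
      using eps_balance[rule_format, of i j y "Suc a" b] by simp
  qed (use lam_nonneg lam_support mu_pos gam_nonneg gam_support gam_bar_pos' xi_pos eta_pos V beta_pos
      theta_pos eps_pos tau_pos tau_balance U_finite L_finite in auto)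
  show ?thesis
    using weight_summable partition_function_eq generator_detailed_balance process_with_generator
    by (intro conjI allI impI) blast+
qed

end
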